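(* Let $Q$ be a quantale. The following conditions are equivalent: (1) $Q$ is a semisimple quantale; (2) $Q$ is strictly faithful and spatial; (3) $Q$ is strictly faithful and $\mathcal{T}(Q)$ is a spatial locale; (4) the union of all cyclic sets of $Q$ is separating.
   Context: A quantale is a complete lattice $Q$ (top $1$, bottom $0$) with an associative multiplication satisfying $a(\bigvee a_i)=\bigvee(aa_i)$ and $(\bigvee a_i)a=\bigvee(a_ia)$ (no unit is assumed). A quantale morphism preserves arbitrary joins and multiplication. An element $a\in Q$ is right-sided if $a1\le a$, left-sided if $1a\le a$, two-sided if both; $\mathcal{R}(Q)$, $\mathcal{L}(Q)$, $\mathcal{T}(Q)$ are the corresponding sets. $\mathcal{T}(Q)$ is a quantale with the joins and multiplication of $Q$; saying that it is a locale means that its multiplication coincides with binary meet, and it is a spatial locale if moreover every element of it is a meet of elements $p\neq 1$ of $\mathcal{T}(Q)$ satisfying, for $u,v\in\mathcal{T}(Q)$, $u\wedge v\le p\Rightarrow u\le p$ or $v\le p$. $Q$ is simple if $1\cdot 1\neq 0$ and every surjective quantale morphism from $Q$ is either an isomorphism or a constant morphism onto a trivial (one-element) quantale. $Q$ is semisimple if it is a subdirect product of simple quantales, i.e. the surjective quantale morphisms from $Q$ onto simple quantales separate the elements of $Q$. $Q$ is strictly faithful if for all $a,b\in Q$: whenever $lar=lbr$ for all $l\in\mathcal{L}(Q)$ and all $r\in\mathcal{R}(Q)$, then $a=b$. An element $p\in Q$ is prime if $a1b\le p$ implies $a\le p$ or $b\le p$, for all $a,b\in Q$. $Q$ is spatial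 if every element of $Q$ is a meet of primes. Residuations: $b\to c=\bigvee\{a\mid ab\le c\}$ and $c\leftarrow a=\bigvee\{b\mid ab\le c\}$. One has $(b\to c)\leftarrow a=b\to(c\leftarrow a)$, written $b\to c\leftarrow a$. A nonempty set $P\subseteq Q$ with $1\notin P$ is cyclic if $\{a\to p\leftarrow b\mid a,b\in Q\}=P\cup\{1\}$ for every $p\in P$. A set $P\subseteq Q$ is separating if for all $a,b\in Q$ with $a\not\geq b$ there is $p\in P$ with $a\le p$ and $b\not\le p$. *)

theory Defs
  imports "HOL-Algebra.Complete_Lattice"
begin

section \<open>Quantales\<close>

record 'a quantale_struct = "'a gorder" +
  qmult :: "['a, 'a] \<Rightarrow> 'a" (infixl \<open>\<cdot>\<index>\<close> 75)

locale quantale = complete_lattice Q for Q :: "'a quantale_struct" (structure) +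
  assumes mult_closed: "\<lbrakk>a \<in> carrier Q; b \<in> carrier Q\<rbrakk> \<Longrightarrow> a \<cdot> b \<in> carrier Q"
    and mult_assoc:
      "\<lbrakk>a \<in> carrier Q; b \<in> carrier Q; c \<in> carrier Q\<rbrakk> \<Longrightarrow> (a \<cdot> b) \<cdot> c = a \<cdot> (b \<cdot> c)"
    and mult_sup_right:
      "\<lbrakk>a \<in> carrier Q; A \<subseteq> carrier Q\<rbrakk> \<Longrightarrow> a \<cdot> (\<Squnion>A) = \<Squnion>((\<lambda>x. a \<cdot> x) ` A)"
    and mult_sup_left:
      "\<lbrakk>a \<in> carrier Q; A \<subseteq> carrier Q\<rbrakk> \<Longrightarrow> (\<Squnion>A) \<cdot> a = \<Squnion>((\<lambda>x. x \<cdot> a) ` A)"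

definition quantale_hom :: "'a quantale_struct \<Rightarrow> 'b quantale_struct \<Rightarrow> ('a \<Rightarrow> 'b) set" where
  "quantale_hom Q R = {f \<in> carrier Q \<rightarrow> carrier R.
     (\<forall>A \<subseteq> carrier Q. f (\<Squnion>\<^bsub>Q\<^esub>A) = \<Squnion>\<^bsub>R\<^esub>(f ` A)) \<and>
     (\<forall>a \<in> carrier Q. \<forall>b \<in> carrier Q. f (a \<cdot>\<^bsub>Q\<^esub> b) = f a \<cdot>\<^bsub>R\<^esub> f b)}"

definition quantale_epi :: "'a quantale_struct \<Rightarrow> 'b quantale_struct \<Rightarrow> ('a \<Rightarrow> 'b) set" where
  "quantale_epi Q R = {f \<in> quantale_hom Q R. f ` carrier Q = carrier R}"

definition quantale_iso :: "'a quantale_struct \<Rightarrow> 'b quantale_struct \<Rightarrow> ('a \<Rightarrow> 'b) set" where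
  "quantale_iso Q R = {f \<in> quantale_hom Q R. \<exists>g \<in> quantale_hom R Q.
     (\<forall>x \<in> carrier Q. g (f x) = x) \<and> (\<forall>y \<in> carrier R. f (g y) = y)}"


section \<open>Sided elements, strict faithfulness\<close>

definition right_sided :: "'a quantale_struct \<Rightarrow> 'a set" where
  "right_sided Q = {a \<in> carrier Q. a \<cdot>\<^bsub>Q\<^esub> \<top>\<^bsub>Q\<^esub> \<sqsubseteq>\<^bsub>Q\<^esub> a}"

definition left_sided :: "'a quantale_struct \<Rightarrow> 'a set" where
  "left_sided Q = {a \<in> carrier Q. \<top>\<^bsub>Q\<^esub> \<cdot>\<^bsub>Q\<^esub> a \<sqsubseteq>\<^bsub>Q\<^esub> a}"

definition two_sided :: "'a quantale_struct \<Rightarrow> 'a set" where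
  "two_sided Q = right_sided Q \<inter> left_sided Q"

definition two_sided_quantale :: "'a quantale_struct \<Rightarrow> 'a quantale_struct" where
  "two_sided_quantale Q = Q\<lparr>carrier := two_sided Q\<rparr>"

definition strictly_faithful :: "'a quantale_struct \<Rightarrow> bool" where
  "strictly_faithful Q \<longleftrightarrow> (\<forall>a \<in> carrier Q. \<forall>b \<in> carrier Q.
     (\<forall>l \<in> left_sided Q. \<forall>r \<in> right_sided Q. l \<cdot>\<^bsub>Q\<^esub> a \<cdot>\<^bsub>Q\<^esub> r = l \<cdot>\<^bsub>Q\<^esub> b \<cdot>\<^bsub>Q\<^esub> r) \<longrightarrow> a = b)"


section \<open>Spatiality\<close>

text \<open>The top element counts as a prime of a quantale, but not as a prime of a locale.\<close>

definition quantale_primes :: "'a quantale_struct \<Rightarrow> 'a set" where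
  "quantale_primes Q = {p \<in> carrier Q. \<forall>a \<in> carrier Q. \<forall>b \<in> carrier Q.
     a \<cdot>\<^bsub>Q\<^esub> \<top>\<^bsub>Q\<^esub> \<cdot>\<^bsub>Q\<^esub> b \<sqsubseteq>\<^bsub>Q\<^esub> p \<longrightarrow> a \<sqsubseteq>\<^bsub>Q\<^esub> p \<or> b \<sqsubseteq>\<^bsub>Q\<^esub> p}"

definition spatial_quantale :: "'a quantale_struct \<Rightarrow> bool" where
  "spatial_quantale Q \<longleftrightarrow> (\<forall>a \<in> carrier Q. \<exists>P \<subseteq> quantale_primes Q. a = \<Sqinter>\<^bsub>Q\<^esub>P)"

definition is_locale :: "'a quantale_struct \<Rightarrow> bool" where
  "is_locale L \<longleftrightarrow> quantale L \<and> (\<forall>u \<in> carrier L. \<forall>v \<in> carrier L. u \<cdot>\<^bsub>L\<^esub> v = u \<sqinter>\<^bsub>L\<^esub> v)"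

definition locale_primes :: "'a quantale_struct \<Rightarrow> 'a set" where
  "locale_primes L = {p \<in> carrier L. p \<noteq> \<top>\<^bsub>L\<^esub> \<and> (\<forall>u \<in> carrier L. \<forall>v \<in> carrier L.
     u \<sqinter>\<^bsub>L\<^esub> v \<sqsubseteq>\<^bsub>L\<^esub> p \<longrightarrow> u \<sqsubseteq>\<^bsub>L\<^esub> p \<or> v \<sqsubseteq>\<^bsub>L\<^esub> p)}"

definition spatial_locale :: "'a quantale_struct \<Rightarrow> bool" where
  "spatial_locale L \<longleftrightarrow> is_locale L \<and> (\<forall>a \<in> carrier L. \<exists>P \<subseteq> locale_primes L. a = \<Sqinter>\<^bsub>L\<^esub>P)"


section \<open>Cyclic and separating sets\<close>

definition left_residual :: "'a quantale_struct \<Rightarrow> 'a \<Rightarrow> 'a \<Rightarrow> 'a" (infixr \<open>\<rightarrow>\<index>\<close> 65) where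
  "b \<rightarrow>\<^bsub>Q\<^esub> c = \<Squnion>\<^bsub>Q\<^esub>{a \<in> carrier Q. a \<cdot>\<^bsub>Q\<^esub> b \<sqsubseteq>\<^bsub>Q\<^esub> c}"

definition right_residual :: "'a quantale_struct \<Rightarrow> 'a \<Rightarrow> 'a \<Rightarrow> 'a" (infixl \<open>\<leftarrow>\<index>\<close> 65) where
  "c \<leftarrow>\<^bsub>Q\<^esub> a = \<Squnion>\<^bsub>Q\<^esub>{b \<in> carrier Q. a \<cdot>\<^bsub>Q\<^esub> b \<sqsubseteq>\<^bsub>Q\<^esub> c}"

definition cyclic_set :: "'a quantale_struct \<Rightarrow> 'a set \<Rightarrow> bool" where
  "cyclic_set Q P \<longleftrightarrow> P \<subseteq> carrier Q \<and> P \<noteq> {} \<and> \<top>\<^bsub>Q\<^esub> \<notin> P \<and>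
     (\<forall>p \<in> P. {(a \<rightarrow>\<^bsub>Q\<^esub> p) \<leftarrow>\<^bsub>Q\<^esub> b | a b. a \<in> carrier Q \<and> b \<in> carrier Q} = P \<union> {\<top>\<^bsub>Q\<^esub>})"

definition separating :: "'a quantale_struct \<Rightarrow> 'a set \<Rightarrow> bool" where
  "separating Q P \<longleftrightarrow> (\<forall>a \<in> carrier Q. \<forall>b \<in> carrier Q.
     \<not> b \<sqsubseteq>\<^bsub>Q\<^esub> a \<longrightarrow> (\<exists>p \<in> P. a \<sqsubseteq>\<^bsub>Q\<^esub> p \<and> \<not> b \<sqsubseteq>\<^bsub>Q\<^esub> p))"


section \<open>Simple and semisimple quantales\<close>

text \<open>
  A HOL definition cannot quantify over all types, so the codomains below are quantales whose
  carriers are arbitrary subsets of the type of the domain.  No generality is lost: the codomain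
  of a surjective morphism from \<open>Q\<close> is isomorphic to a quantale carried by a subset of
  \<open>carrier Q\<close>.  The lemmas \<open>simple_any_codomain\<close> and \<open>semisimple_any_codomain\<close>
  below state the resulting independence from the type of the codomain.
\<close>

definition simple_quantale :: "'a quantale_struct \<Rightarrow> bool" where
  "simple_quantale Q \<longleftrightarrow> quantale Q \<and> \<top>\<^bsub>Q\<^esub> \<cdot>\<^bsub>Q\<^esub> \<top>\<^bsub>Q\<^esub> \<noteq> \<bottom>\<^bsub>Q\<^esub> \<and>
     (\<forall>(R :: 'a quantale_struct) f. quantale R \<longrightarrow> f \<in> quantale_epi Q R \<longrightarrow>
        f \<in> quantale_iso Q R \<or> (\<exists>z. carrier R = {z} \<and> (\<forall>x \<in> carrier Q. f x = z)))"

definition semisimple_quantale :: "'a quantale_struct \<Rightarrow> bool" where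
  "semisimple_quantale Q \<longleftrightarrow> (\<forall>a \<in> carrier Q. \<forall>b \<in> carrier Q. a \<noteq> b \<longrightarrow>
     (\<exists>(R :: 'a quantale_struct) f. simple_quantale R \<and> f \<in> quantale_epi Q R \<and> f a \<noteq> f b))"

subsection \<open>Independence from the type of the codomain\<close>

lemma (in complete_lattice) sup_char:
  assumes "A \<subseteq> carrier L"
  shows "s = \<Squnion>A \<longleftrightarrow> s \<in> carrier L \<and> (\<forall>x \<in> A. x \<sqsubseteq> s) \<and>
    (\<forall>u \<in> carrier L. (\<forall>x \<in> A. x \<sqsubseteq> u) \<longrightarrow> s \<sqsubseteq> u)" (is "_ \<longleftrightarrow> ?R s")
proof -
  have *: "?R (\<Squnion>A)"
    using assms sup_upper sup_least sup_closed by (auto simp: Upper_def)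
  moreover have "s = \<Squnion>A" if "?R s"
    using that * by (intro le_antisym) auto
  ultimately show ?thesis by blast
qed

definition transport :: "('b \<Rightarrow> 'a) \<Rightarrow> 'b quantale_struct \<Rightarrow> 'a quantale_struct" where
  "transport g R = \<lparr>carrier = g ` carrier R, eq = (=),
     le = (\<lambda>x y. inv_into (carrier R) g x \<sqsubseteq>\<^bsub>R\<^esub> inv_into (carrier R) g y),
     qmult = (\<lambda>x y. g (inv_into (carrier R) g x \<cdot>\<^bsub>R\<^esub> inv_into (carrier R) g y))\<rparr>"

lemma quantale_transport:
  fixes R :: "'b quantale_struct" and g :: "'b \<Rightarrow> 'a"
  assumes R: "quantale R" and g: "inj_on g (carrier R)"
  shows "quantale (transport g R)" and "g \<in> quantale_iso R (transport g R)"
proof -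
  interpret R: quantale R by (rule R)
  let ?T = "transport g R"
  have car: "carrier ?T = g ` carrier R" and eq: "(.=\<^bsub>?T\<^esub>) = (=)"
    by (simp_all add: transport_def)
  have le: "g x \<sqsubseteq>\<^bsub>?T\<^esub> g y \<longleftrightarrow> x \<sqsubseteq>\<^bsub>R\<^esub> y" and mult: "g x \<cdot>\<^bsub>?T\<^esub> g y = g (x \<cdot>\<^bsub>R\<^esub> y)"
    if "x \<in> carrier R" "y \<in> carrier R" for x y
    using that g by (simp_all add: transport_def)
  interpret T: partial_order ?T
    by unfold_locales (auto simp: car eq le g[THEN inj_on_eq_iff] intro: R.le_trans R.le_antisym)
  have image: "{u. P u} \<inter> g ` C = g ` ({u. P' u} \<inter> C)" if "\<And>u. u \<in> C \<Longrightarrow> P (g u) = P' u"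
    for P P' C
    using that by (auto intro!: imageI)
  have Upper: "Upper ?T (g ` A) = g ` Upper R A" and Lower: "Lower ?T (g ` A) = g ` Lower R A"
    if "A \<subseteq> carrier R" for A
  proof -
    have A: "g ` A \<inter> carrier ?T = g ` A" "A \<inter> carrier R = A"
      using that by (auto simp: car)
    have bounds: "(\<forall>x. x \<in> g ` A \<longrightarrow> x \<sqsubseteq>\<^bsub>?T\<^esub> g u) \<longleftrightarrow> (\<forall>x. x \<in> A \<longrightarrow> x \<sqsubseteq>\<^bsub>R\<^esub> u)"
      "(\<forall>x. x \<in> g ` A \<longrightarrow> g u \<sqsubseteq>\<^bsub>?T\<^esub> x) \<longleftrightarrow> (\<forall>x. x \<in> A \<longrightarrow> u \<sqsubseteq>\<^bsub>R\<^esub> x)"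
      if "u \<in> carrier R" for u
      using \<open>A \<subseteq> carrier R\<close> that le by blast+
    show "Upper ?T (g ` A) = g ` Upper R A" "Lower ?T (g ` A) = g ` Lower R A"
      unfolding Upper_def Lower_def A unfolding car by (rule image, erule bounds)+
  qed
  have least: "least ?T (g s) (g ` B)" if "least R s B" for s B
    using that by (auto simp: least_def car le subset_iff)
  have greatest: "greatest ?T (g s) (g ` B)" if "greatest R s B" for s B
    using that by (auto simp: greatest_def car le subset_iff)
  interpret T: complete_lattice ?T
  proof (rule T.complete_latticeI)
    fix A assume "A \<subseteq> carrier ?T"
    then obtain B where B: "B \<subseteq> carrier R" "A = g ` B"
      by (metis car subset_imageE)
    show "\<exists>s. least ?T s (Upper ?T A)"
      using R.sup_exists[OF B(1)] least B Upper by metis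
    show "\<exists>i. greatest ?T i (Lower ?T A)"
      using R.inf_exists[OF B(1)] greatest B Lower by metis
  qed
  have sup: "\<Squnion>\<^bsub>?T\<^esub>(g ` A) = g (\<Squnion>\<^bsub>R\<^esub>A)" if "A \<subseteq> carrier R" for A
  proof -
    have "g ` A \<subseteq> carrier ?T"
      using that by (auto simp: car)
    from T.sup_char[OF this, of "g (\<Squnion>\<^bsub>R\<^esub>A)"] show ?thesis
      using R.sup_char[OF that, of "\<Squnion>\<^bsub>R\<^esub>A"] that by (auto simp: car le subset_iff)
  qed
  show Q: "quantale ?T"
  proof
    fix a A assume a: "a \<in> carrier ?T" and A: "A \<subseteq> carrier ?T"
    obtain x where x: "x \<in> carrier R" "a = g x"
      using a by (auto simp: car)
    obtain B where B: "B \<subseteq> carrier R" "A = g ` B"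
      using A by (metis car subset_imageE)
    have B1: "(\<lambda>y. x \<cdot>\<^bsub>R\<^esub> y) ` B \<subseteq> carrier R" "(\<lambda>y. y \<cdot>\<^bsub>R\<^esub> x) ` B \<subseteq> carrier R"
      using x B R.mult_closed by auto
    have "(\<lambda>y. a \<cdot>\<^bsub>?T\<^esub> y) ` A = g ` (\<lambda>y. x \<cdot>\<^bsub>R\<^esub> y) ` B"
      "(\<lambda>y. y \<cdot>\<^bsub>?T\<^esub> a) ` A = g ` (\<lambda>y. y \<cdot>\<^bsub>R\<^esub> x) ` B"
      unfolding x B image_image using x B by (intro image_cong refl; simp add: mult subset_iff)+
    then show "a \<cdot>\<^bsub>?T\<^esub> (\<Squnion>\<^bsub>?T\<^esub>A) = \<Squnion>\<^bsub>?T\<^esub>((\<lambda>y. a \<cdot>\<^bsub>?T\<^esub> y) ` A)"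
      "(\<Squnion>\<^bsub>?T\<^esub>A) \<cdot>\<^bsub>?T\<^esub> a = \<Squnion>\<^bsub>?T\<^esub>((\<lambda>y. y \<cdot>\<^bsub>?T\<^esub> a) ` A)"
      using x B B1
      by (simp_all add: sup mult R.sup_closed R.mult_sup_right R.mult_sup_left)
  qed (auto simp: car mult R.mult_closed R.mult_assoc)
  have "g \<in> quantale_hom R ?T"
    by (auto simp: quantale_hom_def car sup mult)
  moreover have inv: "inv_into (carrier R) g (g x) = x" if "x \<in> carrier R" for x
    using g that by (rule inv_into_f_f)
  moreover have "inv_into (carrier R) g \<in> quantale_hom ?T R"
  proof -
    have "inv_into (carrier R) g (\<Squnion>\<^bsub>?T\<^esub>A) = \<Squnion>\<^bsub>R\<^esub>(inv_into (carrier R) g ` A)"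
      if A: "A \<subseteq> carrier ?T" for A
    proof -
      obtain B where B: "B \<subseteq> carrier R" "A = g ` B"
        using A by (metis car subset_imageE)
      then have "inv_into (carrier R) g ` A = B"
        using g by (simp add: inv_into_image_cancel)
      then show ?thesis
        unfolding B(2) using B(1) by (simp add: sup inv)
    qed
    then show ?thesis
      unfolding quantale_hom_def car by (auto simp: inv mult R.mult_closed)
  qed
  ultimately show "g \<in> quantale_iso R ?T"
    unfolding quantale_iso_def car by (auto intro!: bexI[of _ "inv_into (carrier R) g"])
qed

lemma quantale_homD:
  assumes "f \<in> quantale_hom Q R"
  shows "x \<in> carrier Q \<Longrightarrow> f x \<in> carrier R"
    and "A \<subseteq> carrier Q \<Longrightarrow> f (\<Squnion>\<^bsub>Q\<^esub>A) = \<Squnion>\<^bsub>R\<^esub>(f ` A)"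
    and "\<lbrakk>x \<in> carrier Q; y \<in> carrier Q\<rbrakk> \<Longrightarrow> f (x \<cdot>\<^bsub>Q\<^esub> y) = f x \<cdot>\<^bsub>R\<^esub> f y"
  using assms by (auto simp: quantale_hom_def)

lemma quantale_homI:
  assumes "\<And>x. x \<in> carrier Q \<Longrightarrow> f x \<in> carrier R"
    and "\<And>A. A \<subseteq> carrier Q \<Longrightarrow> f (\<Squnion>\<^bsub>Q\<^esub>A) = \<Squnion>\<^bsub>R\<^esub>(f ` A)"
    and "\<And>x y. \<lbrakk>x \<in> carrier Q; y \<in> carrier Q\<rbrakk> \<Longrightarrow> f (x \<cdot>\<^bsub>Q\<^esub> y) = f x \<cdot>\<^bsub>R\<^esub> f y"
  shows "f \<in> quantale_hom Q R"
  using assms by (auto simp: quantale_hom_def)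

lemma quantale_hom_comp:
  assumes f: "f \<in> quantale_hom Q R" and g: "g \<in> quantale_hom R S"
  shows "g \<circ> f \<in> quantale_hom Q S"
proof (rule quantale_homI)
  fix A assume A: "A \<subseteq> carrier Q"
  then have "f ` A \<subseteq> carrier R"
    using quantale_homD(1)[OF f] by blast
  then show "(g \<circ> f) (\<Squnion>\<^bsub>Q\<^esub>A) = \<Squnion>\<^bsub>S\<^esub>((g \<circ> f) ` A)"
    using A by (simp add: quantale_homD(2)[OF f] quantale_homD(2)[OF g] image_comp)
qed (simp_all add: quantale_homD[OF f] quantale_homD[OF g])

lemma quantale_epi_comp:
  assumes "f \<in> quantale_epi Q R" "g \<in> quantale_epi R S"
  shows "g \<circ> f \<in> quantale_epi Q S"
proof -
  have f: "f \<in> quantale_hom Q R" "f ` carrier Q = carrier R"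
    and g: "g \<in> quantale_hom R S" "g ` carrier R = carrier S"
    using assms by (simp_all add: quantale_epi_def)
  have "(g \<circ> f) ` carrier Q = carrier S"
    by (simp only: image_comp[symmetric] f(2) g(2))
  then show ?thesis
    using quantale_hom_comp[OF f(1) g(1)] by (simp add: quantale_epi_def)
qed

lemma quantale_iso_comp:
  assumes "f \<in> quantale_iso Q R" "g \<in> quantale_iso R S"
  shows "g \<circ> f \<in> quantale_iso Q S"
proof -
  obtain f' where f: "f \<in> quantale_hom Q R" and f': "f' \<in> quantale_hom R Q"
    "\<forall>x \<in> carrier Q. f' (f x) = x" "\<forall>y \<in> carrier R. f (f' y) = y"
    using assms(1) by (auto simp: quantale_iso_def)
  obtain g' where g: "g \<in> quantale_hom R S" and g': "g' \<in> quantale_hom S R"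
    "\<forall>x \<in> carrier R. g' (g x) = x" "\<forall>y \<in> carrier S. g (g' y) = y"
    using assms(2) by (auto simp: quantale_iso_def)
  have "f x \<in> carrier R" if "x \<in> carrier Q" for x
    using f that by (auto simp: quantale_hom_def)
  moreover have "g' x \<in> carrier R" if "x \<in> carrier S" for x
    using g' that by (auto simp: quantale_hom_def)
  ultimately show ?thesis
    using quantale_hom_comp[OF f g] quantale_hom_comp[OF g'(1) f'(1)] f' g'
    by (auto simp: quantale_iso_def intro!: bexI[of _ "f' \<circ> g'"])
qed

lemma quantale_iso_sym:
  assumes "f \<in> quantale_iso Q R"
  obtains g where "g \<in> quantale_iso R Q"
    "\<forall>x \<in> carrier Q. g (f x) = x" "\<forall>y \<in> carrier R. f (g y) = y"
  using assms by (auto simp: quantale_iso_def)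

lemma quantale_iso_epi: "quantale_iso Q R \<subseteq> quantale_epi Q R"
proof
  fix f assume "f \<in> quantale_iso Q R"
  then obtain g where f: "f \<in> quantale_hom Q R" and g: "g \<in> quantale_hom R Q"
    "\<forall>y \<in> carrier R. f (g y) = y"
    by (auto simp: quantale_iso_def)
  then have "y \<in> f ` carrier Q" if "y \<in> carrier R" for y
    using that by (intro image_eqI[of _ _ "g y"]) (auto simp: quantale_hom_def)
  then show "f \<in> quantale_epi Q R"
    using f by (auto simp: quantale_epi_def quantale_hom_def)
qed

lemma quantale_iso_cong:
  assumes "f \<in> quantale_iso Q R" "quantale Q" "\<forall>x \<in> carrier Q. h x = f x"
  shows "h \<in> quantale_iso Q R"
proof -
  interpret Q: quantale Q by (rule assms)
  have f: "f \<in> quantale_hom Q R"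
    using assms by (simp add: quantale_iso_def)
  have "h ` A = f ` A" if "A \<subseteq> carrier Q" for A
    using assms(3) that by (intro image_cong) auto
  then have "h \<in> quantale_hom Q R"
    using f assms(3) by (auto simp: quantale_hom_def Q.mult_closed Q.sup_closed)
  moreover obtain g where g: "g \<in> quantale_hom R Q"
    "\<forall>x \<in> carrier Q. g (f x) = x" "\<forall>y \<in> carrier R. f (g y) = y"
    using assms by (auto simp: quantale_iso_def)
  moreover have "g y \<in> carrier Q" if "y \<in> carrier R" for y
    using g that by (auto simp: quantale_hom_def)
  ultimately show ?thesis
    using assms(3) by (auto simp: quantale_iso_def)
qed

lemma codomain_on_domain_type:
  fixes Q :: "'a quantale_struct" and R :: "'b quantale_struct"
  assumes "quantale R" "f \<in> quantale_epi Q R"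
  obtains S :: "'a quantale_struct" and g
  where "quantale S" "carrier S \<subseteq> carrier Q" "g \<in> quantale_iso R S"
proof -
  let ?g = "inv_into (carrier Q) f"
  have f: "f ` carrier Q = carrier R"
    using assms(2) by (simp add: quantale_epi_def)
  have "inj_on ?g (carrier R)"
    using inj_on_inv_into[of "carrier R" f "carrier Q"] f by simp
  moreover have "carrier (transport ?g R) \<subseteq> carrier Q"
    using f by (auto simp: transport_def intro: inv_into_into)
  ultimately show thesis
    using quantale_transport[OF assms(1)] that by blast
qed

lemma simple_quantaleD:
  fixes Q :: "'a quantale_struct"
  assumes "simple_quantale Q"
  shows "quantale Q" and "\<top>\<^bsub>Q\<^esub> \<cdot>\<^bsub>Q\<^esub> \<top>\<^bsub>Q\<^esub> \<noteq> \<bottom>\<^bsub>Q\<^esub>"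
    and "\<And>(R :: 'a quantale_struct) f. quantale R \<Longrightarrow> f \<in> quantale_epi Q R \<Longrightarrow>
      f \<in> quantale_iso Q R \<or> (\<exists>z. carrier R = {z} \<and> (\<forall>x \<in> carrier Q. f x = z))"
proof -
  note * = assms[unfolded simple_quantale_def]
  show "quantale Q" by (rule conjunct1[OF *])
  show "\<top>\<^bsub>Q\<^esub> \<cdot>\<^bsub>Q\<^esub> \<top>\<^bsub>Q\<^esub> \<noteq> \<bottom>\<^bsub>Q\<^esub>" by (rule conjunct1[OF conjunct2[OF *]])
  show "f \<in> quantale_iso Q R \<or> (\<exists>z. carrier R = {z} \<and> (\<forall>x \<in> carrier Q. f x = z))"
    if "quantale R" "f \<in> quantale_epi Q R" for R :: "'a quantale_struct" and f
    by (rule conjunct2[OF conjunct2[OF *], rule_format, OF that])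
qed

lemma simple_any_codomain:
  fixes Q :: "'a quantale_struct" and R :: "'b quantale_struct"
  assumes "simple_quantale Q" "quantale R" "f \<in> quantale_epi Q R"
  shows "f \<in> quantale_iso Q R \<or> (\<exists>z. carrier R = {z} \<and> (\<forall>x \<in> carrier Q. f x = z))"
proof -
  obtain S :: "'a quantale_struct" and g where S: "quantale S" "carrier S \<subseteq> carrier Q"
    and g: "g \<in> quantale_iso R S"
    by (rule codomain_on_domain_type[OF assms(2,3)])
  obtain h where h: "h \<in> quantale_iso S R"
    "\<forall>x \<in> carrier R. h (g x) = x" "\<forall>y \<in> carrier S. g (h y) = y"
    by (rule quantale_iso_sym[OF g])
  have fR: "f x \<in> carrier R" if "x \<in> carrier Q" for x
    using assms(3) that by (auto simp: quantale_epi_def)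
  have gf: "g \<circ> f \<in> quantale_epi Q S"
    by (rule quantale_epi_comp[OF assms(3) subsetD[OF quantale_iso_epi g]])
  consider "g \<circ> f \<in> quantale_iso Q S"
    | z where "carrier S = {z}"
    using simple_quantaleD(3)[OF assms(1) S(1) gf] by blast
  then show ?thesis
  proof cases
    case 1
    then have "h \<circ> (g \<circ> f) \<in> quantale_iso Q R"
      using h(1) quantale_iso_comp by blast
    then show ?thesis
      using quantale_iso_cong[of "h \<circ> (g \<circ> f)" Q R f] simple_quantaleD(1)[OF assms(1)] h fR
      by auto
  next
    case 2
    have "h ` carrier S = carrier R"
      using subsetD[OF quantale_iso_epi h(1)] by (simp add: quantale_epi_def)
    then have "carrier R = {h z}"
      unfolding 2 by simp
    then show ?thesis
      using fR by blast
  qed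
qed

lemma simple_iso:
  fixes R :: "'b quantale_struct" and S :: "'a quantale_struct"
  assumes R: "simple_quantale R" and S: "quantale S" and g: "g \<in> quantale_iso R S"
  shows "simple_quantale S"
proof -
  interpret R: quantale R using simple_quantaleD(1)[OF R] .
  interpret S: quantale S by (rule S)
  obtain h where h: "h \<in> quantale_iso S R"
    "\<forall>x \<in> carrier R. h (g x) = x" "\<forall>y \<in> carrier S. g (h y) = y"
    by (rule quantale_iso_sym[OF g])
  have gh: "g \<in> quantale_hom R S" "h \<in> quantale_hom S R"
    using g h by (auto simp: quantale_iso_def)
  have bot: "\<bottom>\<^bsub>X\<^esub> = \<Squnion>\<^bsub>X\<^esub>{}" and top: "\<top>\<^bsub>X\<^esub> = \<Squnion>\<^bsub>X\<^esub>(carrier X)"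
    if "complete_lattice X" for X :: "'c quantale_struct"
  proof -
    interpret X: complete_lattice X by (rule that)
    show "\<bottom>\<^bsub>X\<^esub> = \<Squnion>\<^bsub>X\<^esub>{}" by (subst X.sup_char) auto
    show "\<top>\<^bsub>X\<^esub> = \<Squnion>\<^bsub>X\<^esub>(carrier X)" by (subst X.sup_char) auto
  qed
  have "h \<bottom>\<^bsub>S\<^esub> = \<bottom>\<^bsub>R\<^esub>"
    using gh bot[OF S.complete_lattice_axioms] bot[OF R.complete_lattice_axioms]
    by (simp add: quantale_hom_def)
  moreover have "h \<top>\<^bsub>S\<^esub> = \<top>\<^bsub>R\<^esub>"
  proof -
    have "h ` carrier S = carrier R"
      using subsetD[OF quantale_iso_epi h(1)] by (simp add: quantale_epi_def)
    then show ?thesis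
      using gh top[OF S.complete_lattice_axioms] top[OF R.complete_lattice_axioms]
      by (simp add: quantale_hom_def)
  qed
  moreover have "h (\<top>\<^bsub>S\<^esub> \<cdot>\<^bsub>S\<^esub> \<top>\<^bsub>S\<^esub>) = h \<top>\<^bsub>S\<^esub> \<cdot>\<^bsub>R\<^esub> h \<top>\<^bsub>S\<^esub>"
    using gh S.top_closed by (auto simp: quantale_hom_def)
  ultimately have "\<top>\<^bsub>S\<^esub> \<cdot>\<^bsub>S\<^esub> \<top>\<^bsub>S\<^esub> \<noteq> \<bottom>\<^bsub>S\<^esub>"
    using simple_quantaleD(2)[OF R] by metis
  moreover have "f \<in> quantale_iso S X \<or> (\<exists>z. carrier X = {z} \<and> (\<forall>x \<in> carrier S. f x = z))"
    if "quantale X" "f \<in> quantale_epi S X" for X :: "'a quantale_struct" and f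
  proof -
    have fX: "f x \<in> carrier X" if "x \<in> carrier S" for x
      using \<open>f \<in> quantale_epi S X\<close> that by (auto simp: quantale_epi_def)
    have fg: "f \<circ> g \<in> quantale_epi R X"
      by (rule quantale_epi_comp[OF subsetD[OF quantale_iso_epi g] that(2)])
    consider "f \<circ> g \<in> quantale_iso R X" | z where "carrier X = {z}"
      using simple_any_codomain[OF R \<open>quantale X\<close> fg] by blast
    then show ?thesis
    proof cases
      case 1
      then have "(f \<circ> g) \<circ> h \<in> quantale_iso S X"
        using h(1) quantale_iso_comp by blast
      then show ?thesis
        using quantale_iso_cong[of "(f \<circ> g) \<circ> h" S X f] S h by auto
    next
      case 2
      then show ?thesis using fX by blast
    qed
  qed
  ultimately show ?thesis
    unfolding simple_quantale_def using S by blast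
qed

lemma semisimple_any_codomain:
  fixes Q :: "'a quantale_struct" and R :: "'b quantale_struct"
  assumes "simple_quantale R" "f \<in> quantale_epi Q R"
    and "a \<in> carrier Q" "b \<in> carrier Q" "f a \<noteq> f b"
  shows "\<exists>(S :: 'a quantale_struct) g. simple_quantale S \<and> g \<in> quantale_epi Q S \<and> g a \<noteq> g b"
proof -
  have R: "quantale R"
    by (rule simple_quantaleD(1)[OF assms(1)])
  obtain S :: "'a quantale_struct" and g where S: "quantale S" "carrier S \<subseteq> carrier Q"
    and g: "g \<in> quantale_iso R S"
    by (rule codomain_on_domain_type[OF R assms(2)])
  obtain h where h: "h \<in> quantale_iso S R"
    "\<forall>x \<in> carrier R. h (g x) = x" "\<forall>y \<in> carrier S. g (h y) = y"
    by (rule quantale_iso_sym[OF g])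
  have "f a \<in> carrier R" "f b \<in> carrier R"
    using assms by (auto simp: quantale_epi_def)
  then have "(g \<circ> f) a \<noteq> (g \<circ> f) b"
    using h assms(5) by (metis comp_apply)
  moreover have "g \<circ> f \<in> quantale_epi Q S"
    by (rule quantale_epi_comp[OF assms(2) subsetD[OF quantale_iso_epi g]])
  ultimately show ?thesis
    using simple_iso[OF assms(1) S(1) g] by blast
qed

end

theory Submission
  imports Defs
begin

text \<open>
  All four conditions say that the two-sided primes \<open>t \<noteq> 1\<close> of \<open>Q\<close> separate its elements in
  the following sense: if \<open>b \<le> a\<close> fails, then some such \<open>t\<close> and some \<open>c, d\<close> satisfy
  \<open>d a c \<le> t\<close> but not \<open>d b c \<le> t\<close>; here \<open>1\<close> is the top and \<open>0\<close> the bottom of \<open>Q\<close>.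
  Equivalently, the residuals \<open>c \<rightarrow> t \<leftarrow> d\<close> of such primes form a separating set. This
  condition is called \<open>prime_residuals_separate\<close> below, and the theorem compares each of the
  four conditions with it.

  Cyclic sets are nothing but the sets \<open>{c \<rightarrow> t \<leftarrow> d} - {1}\<close> for a two-sided prime \<open>t \<noteq> 1\<close>.
  Given \<open>t\<close>, primeness makes \<open>d 1 w 1 c \<le> t\<close> equivalent to \<open>w \<le> t\<close> for \<open>d, c\<close> not below \<open>t\<close>,
  so that every residual of \<open>t\<close> is also a residual of every other one that differs from \<open>1\<close>
  (\<open>residuals_cyclic\<close>). Conversely, a cyclic set contains \<open>1 \<rightarrow> p \<leftarrow> 1\<close> for each of its members
  \<open>p\<close>, and this element is such a prime (\<open>cyclic_from_prime\<close>).

  If the residuals separate, then \<open>Q\<close> is strictly faithful, because \<open>d x c \<le> t\<close> amounts to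
  \<open>(1 d) x (c 1) \<le> t\<close> with \<open>1 d\<close> left-sided and \<open>c 1\<close> right-sided; and \<open>Q\<close> is spatial,
  because the residuals of \<open>t\<close> are prime. If \<open>Q\<close> is spatial, then the quantale of two-sided
  elements is a spatial locale: below a prime of \<open>Q\<close> other than \<open>1\<close> there is a largest
  two-sided element, and it is a prime of the locale. Finally, suppose that \<open>Q\<close> is strictly
  faithful with a spatial locale of two-sided elements. If \<open>b \<le> a\<close> fails, strict faithfulness
  gives \<open>l, r\<close> for which \<open>l b r \<le> l a r\<close> fails; these products are two-sided, so a prime of
  the locale separates them, and the primes of the locale are two-sided primes of \<open>Q\<close>.

  Simple quotients of \<open>Q\<close> come from the same primes. A two-sided prime \<open>t \<noteq> 1\<close> defines a
  nucleus, sending \<open>x\<close> to the largest \<open>y\<close> such that \<open>d y c \<le> t\<close> whenever \<open>d x c \<le> t\<close>. In its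
  quotient the bottom element is \<open>t\<close>, and \<open>1 w 1 = 1\<close> for every other \<open>w\<close>; so identifying two
  elements identifies bottom and top, and the quotient is simple
  (\<open>saturation_quotient_simple\<close>). Conversely, in a simple quantale every nucleus is the
  identity or constant. Applied to joining with a two-sided element, this shows that bottom
  is prime (\<open>simple_bot_prime\<close>); applied to the nucleus of this prime, it shows that the
  residuals of bottom separate. A morphism from \<open>Q\<close> onto a simple quantale pulls all of this
  back to \<open>Q\<close>.
\<close>

section \<open>Arithmetic in a quantale\<close>

context quantale
begin

lemma sup_le_iff:
  assumes "A \<subseteq> carrier Q" "u \<in> carrier Q"
  shows "\<Squnion>A \<sqsubseteq> u \<longleftrightarrow> (\<forall>x \<in> A. x \<sqsubseteq> u)"
proof
  assume "\<Squnion>A \<sqsubseteq> u"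
  then show "\<forall>x \<in> A. x \<sqsubseteq> u"
    using assms sup_upper sup_closed le_trans by (meson subsetD)
qed (use assms sup_least in simp)

lemma sup_pair:
  assumes "a \<sqsubseteq> b" "a \<in> carrier Q" "b \<in> carrier Q"
  shows "\<Squnion>{a, b} = b"
  using assms by (subst eq_commute, subst sup_char) auto

text \<open>
  Residuals are defined as joins but used only through the elements below them; equalities between
  residuals are proved by comparing these.
\<close>

lemma eq_if_below_same:
  assumes "a \<in> carrier Q" "b \<in> carrier Q" "\<And>x. x \<in> carrier Q \<Longrightarrow> x \<sqsubseteq> a \<longleftrightarrow> x \<sqsubseteq> b"
  shows "a = b"
  using assms(1,2) assms(3)[of a] assms(3)[of b] by (intro le_antisym) simp_all

lemma mult_mono_right:
  assumes "a \<in> carrier Q" "b \<in> carrier Q" "c \<in> carrier Q" "b \<sqsubseteq> c"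
  shows "a \<cdot> b \<sqsubseteq> a \<cdot> c"
proof -
  have "a \<cdot> c = \<Squnion>((\<lambda>x. a \<cdot> x) ` {b, c})"
    using mult_sup_right[of a "{b, c}"] assms by (simp add: sup_pair)
  then show ?thesis
    using sup_upper[of "{a \<cdot> b, a \<cdot> c}" "a \<cdot> b"] assms by (simp add: mult_closed)
qed

lemma mult_mono_left:
  assumes "a \<in> carrier Q" "b \<in> carrier Q" "c \<in> carrier Q" "b \<sqsubseteq> c"
  shows "b \<cdot> a \<sqsubseteq> c \<cdot> a"
proof -
  have "c \<cdot> a = \<Squnion>((\<lambda>x. x \<cdot> a) ` {b, c})"
    using mult_sup_left[of a "{b, c}"] assms by (simp add: sup_pair)
  then show ?thesis
    using sup_upper[of "{b \<cdot> a, c \<cdot> a}" "b \<cdot> a"] assms by (simp add: mult_closed)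
qed

lemma mult_mono:
  assumes "a \<in> carrier Q" "a' \<in> carrier Q" "b \<in> carrier Q" "b' \<in> carrier Q" "a \<sqsubseteq> a'" "b \<sqsubseteq> b'"
  shows "a \<cdot> b \<sqsubseteq> a' \<cdot> b'"
  using le_trans[OF mult_mono_left[of b a a'] mult_mono_right[of a' b b']] assms
  by (simp add: mult_closed)

lemma bot_eq_sup: "\<bottom> = \<Squnion>{}"
  by (subst sup_char) auto

lemma top_eq_sup: "\<top> = \<Squnion>(carrier Q)"
  by (subst sup_char) auto

lemma mult_bot:
  assumes "a \<in> carrier Q"
  shows "a \<cdot> \<bottom> = \<bottom>" "\<bottom> \<cdot> a = \<bottom>"
  using mult_sup_right[OF assms, of "{}"] mult_sup_left[OF assms, of "{}"]
  by (simp_all add: bot_eq_sup)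

lemma le_bot_iff: "x \<in> carrier Q \<Longrightarrow> x \<sqsubseteq> \<bottom> \<longleftrightarrow> x = \<bottom>"
  using le_antisym[of x \<bottom>] by auto

lemma top_le_iff: "x \<in> carrier Q \<Longrightarrow> \<top> \<sqsubseteq> x \<longleftrightarrow> x = \<top>"
  using le_antisym[of x \<top>] top_higher by auto

lemma le_left_residual:
  assumes "x \<in> carrier Q" "c \<in> carrier Q" "t \<in> carrier Q"
  shows "x \<sqsubseteq> c \<rightarrow>\<^bsub>Q\<^esub> t \<longleftrightarrow> x \<cdot> c \<sqsubseteq> t"
proof -
  let ?A = "{a \<in> carrier Q. a \<cdot> c \<sqsubseteq> t}"
  have A: "?A \<subseteq> carrier Q" by auto
  have "\<Squnion>?A \<cdot> c \<sqsubseteq> t"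
    using mult_sup_left[OF assms(2) A] assms by (auto simp: sup_le_iff mult_closed image_subset_iff)
  then have "x \<cdot> c \<sqsubseteq> t" if "x \<sqsubseteq> \<Squnion>?A"
    using le_trans[OF mult_mono_left[of c x "\<Squnion>?A"]] that assms sup_closed[OF A]
    by (simp add: mult_closed)
  then show ?thesis
    unfolding left_residual_def using assms sup_upper[OF A, of x] by blast
qed

lemma le_right_residual:
  assumes "x \<in> carrier Q" "c \<in> carrier Q" "t \<in> carrier Q"
  shows "x \<sqsubseteq> t \<leftarrow>\<^bsub>Q\<^esub> c \<longleftrightarrow> c \<cdot> x \<sqsubseteq> t"
proof -
  let ?A = "{a \<in> carrier Q. c \<cdot> a \<sqsubseteq> t}"
  have A: "?A \<subseteq> carrier Q" by auto
  have "c \<cdot> \<Squnion>?A \<sqsubseteq> t"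
    using mult_sup_right[OF assms(2) A] assms by (auto simp: sup_le_iff mult_closed image_subset_iff)
  then have "c \<cdot> x \<sqsubseteq> t" if "x \<sqsubseteq> \<Squnion>?A"
    using le_trans[OF mult_mono_right[of c x "\<Squnion>?A"]] that assms sup_closed[OF A]
    by (simp add: mult_closed)
  then show ?thesis
    unfolding right_residual_def using assms sup_upper[OF A, of x] by blast
qed

lemma left_residual_closed: "c \<rightarrow>\<^bsub>Q\<^esub> t \<in> carrier Q"
  unfolding left_residual_def by (rule sup_closed) auto

lemma residual_closed: "(c \<rightarrow>\<^bsub>Q\<^esub> t) \<leftarrow>\<^bsub>Q\<^esub> d \<in> carrier Q"
  unfolding right_residual_def by (rule sup_closed) auto

lemma le_residual:
  assumes "x \<in> carrier Q" "c \<in> carrier Q" "d \<in> carrier Q" "t \<in> carrier Q"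
  shows "x \<sqsubseteq> (c \<rightarrow>\<^bsub>Q\<^esub> t) \<leftarrow>\<^bsub>Q\<^esub> d \<longleftrightarrow> d \<cdot> x \<cdot> c \<sqsubseteq> t"
  using assms by (simp add: le_right_residual le_left_residual left_residual_closed mult_closed)

lemma residual_eqI:
  assumes "\<And>x. x \<in> carrier Q \<Longrightarrow> d \<cdot> x \<cdot> c \<sqsubseteq> t \<longleftrightarrow> d' \<cdot> x \<cdot> c' \<sqsubseteq> t'"
    and "c \<in> carrier Q" "d \<in> carrier Q" "t \<in> carrier Q"
    and "c' \<in> carrier Q" "d' \<in> carrier Q" "t' \<in> carrier Q"
  shows "(c \<rightarrow>\<^bsub>Q\<^esub> t) \<leftarrow>\<^bsub>Q\<^esub> d = (c' \<rightarrow>\<^bsub>Q\<^esub> t') \<leftarrow>\<^bsub>Q\<^esub> d'"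
  by (rule eq_if_below_same)
    (use assms in \<open>simp_all add: residual_closed le_residual\<close>)

text \<open>
  Iterated residuals are single residuals.  This is why the residuals of one element are closed
  under forming residuals.
\<close>

lemma residual_residual:
  assumes "c \<in> carrier Q" "d \<in> carrier Q" "c' \<in> carrier Q" "d' \<in> carrier Q" "t \<in> carrier Q"
  shows "(c \<rightarrow>\<^bsub>Q\<^esub> ((c' \<rightarrow>\<^bsub>Q\<^esub> t) \<leftarrow>\<^bsub>Q\<^esub> d')) \<leftarrow>\<^bsub>Q\<^esub> d = ((c \<cdot> c') \<rightarrow>\<^bsub>Q\<^esub> t) \<leftarrow>\<^bsub>Q\<^esub> (d' \<cdot> d)"
  by (rule residual_eqI)
    (use assms in \<open>simp_all add: residual_closed le_residual mult_closed mult_assoc\<close>)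

lemma residual_bot:
  assumes "c \<in> carrier Q" "t \<in> carrier Q"
  shows "(c \<rightarrow>\<^bsub>Q\<^esub> t) \<leftarrow>\<^bsub>Q\<^esub> \<bottom> = \<top>"
  using le_residual[of \<top> c \<bottom> t] assms residual_closed
  by (simp add: top_le_iff mult_bot)

lemma sandwich_le_top:
  assumes "a \<in> carrier Q" "b \<in> carrier Q" "x \<in> carrier Q"
  shows "b \<cdot> x \<cdot> a \<sqsubseteq> \<top> \<cdot> x \<cdot> \<top>"
  using assms by (intro mult_mono) (simp_all add: mult_closed)

end


section \<open>Two-sided primes and their residuals\<close>

definition two_sided_primes :: "'a quantale_struct \<Rightarrow> 'a set" where
  "two_sided_primes Q = two_sided Q \<inter> quantale_primes Q - {\<top>\<^bsub>Q\<^esub>}"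

definition residuals :: "'a quantale_struct \<Rightarrow> 'a \<Rightarrow> 'a set" where
  "residuals Q t = {(a \<rightarrow>\<^bsub>Q\<^esub> t) \<leftarrow>\<^bsub>Q\<^esub> b | a b. a \<in> carrier Q \<and> b \<in> carrier Q}"

definition prime_residuals_separate :: "'a quantale_struct \<Rightarrow> bool" where
  "prime_residuals_separate Q \<longleftrightarrow> (\<forall>a \<in> carrier Q. \<forall>b \<in> carrier Q. \<not> b \<sqsubseteq>\<^bsub>Q\<^esub> a \<longrightarrow>
     (\<exists>t \<in> two_sided_primes Q. \<exists>c \<in> carrier Q. \<exists>d \<in> carrier Q.
        d \<cdot>\<^bsub>Q\<^esub> a \<cdot>\<^bsub>Q\<^esub> c \<sqsubseteq>\<^bsub>Q\<^esub> t \<and> \<not> d \<cdot>\<^bsub>Q\<^esub> b \<cdot>\<^bsub>Q\<^esub> c \<sqsubseteq>\<^bsub>Q\<^esub> t))"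

lemma prime_residuals_separateD:
  assumes "prime_residuals_separate Q" "a \<in> carrier Q" "b \<in> carrier Q" "\<not> b \<sqsubseteq>\<^bsub>Q\<^esub> a"
  shows "\<exists>t \<in> two_sided_primes Q. \<exists>c \<in> carrier Q. \<exists>d \<in> carrier Q.
    d \<cdot>\<^bsub>Q\<^esub> a \<cdot>\<^bsub>Q\<^esub> c \<sqsubseteq>\<^bsub>Q\<^esub> t \<and> \<not> d \<cdot>\<^bsub>Q\<^esub> b \<cdot>\<^bsub>Q\<^esub> c \<sqsubseteq>\<^bsub>Q\<^esub> t"
  using assms by (simp add: prime_residuals_separate_def)

context quantale
begin

lemma two_sided_iff:
  "t \<in> two_sided Q \<longleftrightarrow> t \<in> carrier Q \<and> t \<cdot> \<top> \<sqsubseteq> t \<and> \<top> \<cdot> t \<sqsubseteq> t"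
  by (auto simp: two_sided_def right_sided_def left_sided_def)

lemma two_sided_mult:
  assumes "t \<in> two_sided Q" "x \<in> carrier Q" "x \<sqsubseteq> t" "d \<in> carrier Q"
  shows "d \<cdot> x \<sqsubseteq> t" "x \<cdot> d \<sqsubseteq> t"
proof -
  have "d \<cdot> x \<sqsubseteq> \<top> \<cdot> t" "x \<cdot> d \<sqsubseteq> t \<cdot> \<top>"
    using assms by (auto intro!: mult_mono simp: two_sided_iff)
  then show "d \<cdot> x \<sqsubseteq> t" "x \<cdot> d \<sqsubseteq> t"
    using assms by (auto simp: two_sided_iff mult_closed intro: le_trans)
qed

lemma two_sided_primeD:
  assumes "t \<in> two_sided_primes Q"
  shows "t \<in> carrier Q" "t \<in> two_sided Q" "\<not> \<top> \<sqsubseteq> t"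
    and "\<lbrakk>a \<in> carrier Q; b \<in> carrier Q; a \<cdot> \<top> \<cdot> b \<sqsubseteq> t\<rbrakk> \<Longrightarrow> a \<sqsubseteq> t \<or> b \<sqsubseteq> t"
  using assms by (auto simp: two_sided_primes_def quantale_primes_def top_le_iff)

text \<open>
  The form in which primeness is used for residuals, where an element \<open>w\<close> is multiplied from both
  sides.
\<close>

lemma prime_triple:
  assumes t: "t \<in> two_sided_primes Q" and "d \<in> carrier Q" "w \<in> carrier Q" "c \<in> carrier Q"
    and "d \<cdot> \<top> \<cdot> w \<cdot> \<top> \<cdot> c \<sqsubseteq> t"
  shows "d \<sqsubseteq> t \<or> w \<sqsubseteq> t \<or> c \<sqsubseteq> t"
  using assms two_sided_primeD(4)[OF t, of d "w \<cdot> \<top> \<cdot> c"] two_sided_primeD(4)[OF t, of w c]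
  by (auto simp: mult_assoc mult_closed)

lemma prime_sandwich:
  assumes t: "t \<in> two_sided_primes Q" and w: "w \<in> carrier Q"
  shows "\<top> \<cdot> w \<cdot> \<top> \<sqsubseteq> t \<longleftrightarrow> w \<sqsubseteq> t"
proof
  assume *: "\<top> \<cdot> w \<cdot> \<top> \<sqsubseteq> t"
  have "\<top> \<cdot> (\<top> \<cdot> w \<cdot> \<top>) \<cdot> \<top> \<sqsubseteq> t"
    using two_sided_mult[OF two_sided_primeD(2)[OF t]] * w by (simp add: mult_closed)
  then have "\<top> \<cdot> \<top> \<cdot> w \<cdot> \<top> \<cdot> \<top> \<sqsubseteq> t"
    using w by (simp add: mult_closed mult_assoc)
  then show "w \<sqsubseteq> t"
    using prime_triple[OF t, of \<top> w \<top>] two_sided_primeD(3)[OF t] w by auto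
next
  assume "w \<sqsubseteq> t"
  then show "\<top> \<cdot> w \<cdot> \<top> \<sqsubseteq> t"
    using two_sided_mult[OF two_sided_primeD(2)[OF t]] w by (simp add: mult_closed)
qed

lemma residualsI:
  "\<lbrakk>a \<in> carrier Q; b \<in> carrier Q\<rbrakk> \<Longrightarrow> (a \<rightarrow>\<^bsub>Q\<^esub> t) \<leftarrow>\<^bsub>Q\<^esub> b \<in> residuals Q t"
  by (auto simp: residuals_def)

text \<open>
  A residual \<open>c \<rightarrow> t \<leftarrow> d\<close> differs from \<open>1\<close> only if neither \<open>c\<close> nor \<open>d\<close> is below \<open>t\<close>.  By primeness
  the residuals of \<open>t\<close> can then be recovered from it: \<open>c' \<rightarrow> t \<leftarrow> d'\<close> is its residual by \<open>c' 1\<close> and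
  \<open>1 d'\<close>, the factors \<open>1\<close> being there so that \<open>prime_triple\<close> applies.
\<close>

lemma residuals_cyclic:
  assumes t: "t \<in> two_sided_primes Q"
  shows "cyclic_set Q (residuals Q t - {\<top>})"
proof -
  note tD = two_sided_primeD[OF t] and tM = two_sided_mult[OF two_sided_primeD(2)[OF t]]
  have res: "residuals Q q = residuals Q t" if "q \<in> residuals Q t" "q \<noteq> \<top>" for q
  proof
    obtain c d where cd: "c \<in> carrier Q" "d \<in> carrier Q" and q: "q = (c \<rightarrow>\<^bsub>Q\<^esub> t) \<leftarrow>\<^bsub>Q\<^esub> d"
      using \<open>q \<in> residuals Q t\<close> by (auto simp: residuals_def)
    show "residuals Q q \<subseteq> residuals Q t"
    proof
      fix x assume "x \<in> residuals Q q"
      then obtain a b where "a \<in> carrier Q" "b \<in> carrier Q" "x = (a \<rightarrow>\<^bsub>Q\<^esub> q) \<leftarrow>\<^bsub>Q\<^esub> b"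
        by (auto simp: residuals_def)
      then show "x \<in> residuals Q t"
        unfolding q using cd tD(1) by (simp add: residual_residual residualsI mult_closed)
    qed
    have "\<not> d \<cdot> \<top> \<cdot> c \<sqsubseteq> t"
      using \<open>q \<noteq> \<top>\<close> le_residual[of \<top> c d t] cd tD(1) by (simp add: q top_le_iff residual_closed)
    then have no: "\<not> d \<sqsubseteq> t" "\<not> c \<sqsubseteq> t"
      using tM cd by (auto simp: mult_closed)
    have "(c' \<rightarrow>\<^bsub>Q\<^esub> t) \<leftarrow>\<^bsub>Q\<^esub> d' = ((c' \<cdot> \<top>) \<rightarrow>\<^bsub>Q\<^esub> q) \<leftarrow>\<^bsub>Q\<^esub> (\<top> \<cdot> d')"
      if cd': "c' \<in> carrier Q" "d' \<in> carrier Q" for c' d'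
    proof -
      have "d' \<cdot> x \<cdot> c' \<sqsubseteq> t \<longleftrightarrow> (d \<cdot> (\<top> \<cdot> d')) \<cdot> x \<cdot> (c' \<cdot> \<top> \<cdot> c) \<sqsubseteq> t" if x: "x \<in> carrier Q" for x
      proof -
        have eq: "(d \<cdot> (\<top> \<cdot> d')) \<cdot> x \<cdot> (c' \<cdot> \<top> \<cdot> c) = d \<cdot> \<top> \<cdot> (d' \<cdot> x \<cdot> c') \<cdot> \<top> \<cdot> c"
          using cd cd' x by (simp add: mult_closed mult_assoc)
        show ?thesis
          unfolding eq using prime_triple[OF t, of d "d' \<cdot> x \<cdot> c'" c] no cd cd' x tM
          by (auto simp: mult_closed)
      qed
      then show ?thesis
        unfolding q using cd cd' tD(1)
        by (subst residual_residual) (auto intro!: residual_eqI simp: mult_closed)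
    qed
    note eq = this
    show "residuals Q t \<subseteq> residuals Q q"
    proof
      fix x assume "x \<in> residuals Q t"
      then obtain a b where "a \<in> carrier Q" "b \<in> carrier Q" "x = (a \<rightarrow>\<^bsub>Q\<^esub> t) \<leftarrow>\<^bsub>Q\<^esub> b"
        by (auto simp: residuals_def)
      then show "x \<in> residuals Q q"
        by (simp add: eq residualsI mult_closed)
    qed
  qed
  have top: "\<top> \<in> residuals Q t"
    using residual_bot[of \<top> t] residualsI[of \<top> \<bottom> t] tD(1) by simp
  have "\<not> \<top> \<cdot> \<top> \<cdot> \<top> \<sqsubseteq> t"
    using prime_sandwich[OF t, of \<top>] tD by simp
  then have "(\<top> \<rightarrow>\<^bsub>Q\<^esub> t) \<leftarrow>\<^bsub>Q\<^esub> \<top> \<noteq> \<top>"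
    using le_residual[of \<top> \<top> \<top> t] tD(1) by (metis le_refl top_closed)
  then have ne: "residuals Q t - {\<top>} \<noteq> {}"
    using residualsI[of \<top> \<top> t] by auto
  have "residuals Q t \<subseteq> carrier Q"
    by (auto simp: residuals_def residual_closed)
  then show ?thesis
    unfolding cyclic_set_def using res ne top by (auto simp: residuals_def[symmetric])
qed

text \<open>
  The residual by \<open>1\<close> on both sides is the smallest one.
\<close>

lemma residual_top_mono:
  assumes "c \<in> carrier Q" "d \<in> carrier Q" "p \<in> carrier Q" "x \<in> carrier Q"
    and "\<top> \<cdot> x \<cdot> \<top> \<sqsubseteq> p"
  shows "x \<sqsubseteq> (c \<rightarrow>\<^bsub>Q\<^esub> p) \<leftarrow>\<^bsub>Q\<^esub> d"
  using assms sandwich_le_top[of c d x] le_trans[of "d \<cdot> x \<cdot> c" "\<top> \<cdot> x \<cdot> \<top>" p]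
  by (simp add: le_residual mult_closed)

lemma sandwich_two_sided:
  assumes x: "x \<in> carrier Q"
  shows "\<top> \<cdot> x \<cdot> \<top> \<in> two_sided Q"
proof -
  have "\<top> \<cdot> x \<cdot> (\<top> \<cdot> \<top>) \<sqsubseteq> \<top> \<cdot> x \<cdot> \<top>" "(\<top> \<cdot> \<top>) \<cdot> x \<cdot> \<top> \<sqsubseteq> \<top> \<cdot> x \<cdot> \<top>"
    using x by (auto intro!: mult_mono simp: mult_closed)
  then show ?thesis
    using x by (simp add: two_sided_iff mult_closed mult_assoc)
qed

lemma residual_top_two_sided:
  assumes p: "p \<in> carrier Q"
  shows "(\<top> \<rightarrow>\<^bsub>Q\<^esub> p) \<leftarrow>\<^bsub>Q\<^esub> \<top> \<in> two_sided Q" (is "?t \<in> _")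
proof -
  have t: "?t \<in> carrier Q" "\<top> \<cdot> ?t \<cdot> \<top> \<sqsubseteq> p"
    using le_residual[of ?t \<top> \<top> p] p by (simp_all add: residual_closed)
  have "\<top> \<cdot> ?t \<cdot> (\<top> \<cdot> \<top>) \<sqsubseteq> \<top> \<cdot> ?t \<cdot> \<top>" "(\<top> \<cdot> \<top>) \<cdot> ?t \<cdot> \<top> \<sqsubseteq> \<top> \<cdot> ?t \<cdot> \<top>"
    using t by (auto intro!: mult_mono simp: mult_closed)
  then have "\<top> \<cdot> ?t \<cdot> (\<top> \<cdot> \<top>) \<sqsubseteq> p" "(\<top> \<cdot> \<top>) \<cdot> ?t \<cdot> \<top> \<sqsubseteq> p"
    using le_trans[OF _ t(2)] t(1) p by (simp_all add: mult_closed)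
  then show ?thesis
    using t(1) p by (simp add: two_sided_iff le_residual mult_closed mult_assoc)
qed

text \<open>
  For \<open>p\<close> in a cyclic set \<open>P\<close>, the element \<open>t = (1 \<rightarrow> p \<leftarrow> 1)\<close> is the smallest residual of \<open>p\<close>.  It
  lies in \<open>P\<close>: writing \<open>p\<close> as a residual of itself twice over shows that \<open>1 1 1 \<le> p\<close> would force
  \<open>p = 1\<close>.  For primeness, let \<open>x 1 y \<le> t\<close> without \<open>y \<le> t\<close>.  Then \<open>1 x 1\<close> is below the residual
  \<open>y 1 \<rightarrow> p\<close>, which belongs to \<open>P\<close>; as every member of \<open>P\<close> is a residual of every other one, \<open>x\<close>
  is below all of \<open>P\<close>, hence below \<open>t\<close>.
\<close>

lemma cyclic_from_prime:
  assumes P: "cyclic_set Q P"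
  obtains t where "t \<in> two_sided_primes Q" "P = residuals Q t - {\<top>}"
proof -
  have PQ: "P \<subseteq> carrier Q" and topP: "\<top> \<notin> P" and cyc: "\<And>p. p \<in> P \<Longrightarrow> residuals Q p = P \<union> {\<top>}"
    using P by (auto simp: cyclic_set_def residuals_def)
  obtain p where p: "p \<in> P"
    using P by (auto simp: cyclic_set_def)
  have pQ: "p \<in> carrier Q"
    using p PQ by auto
  have express: "\<exists>c \<in> carrier Q. \<exists>d \<in> carrier Q. q' = (c \<rightarrow>\<^bsub>Q\<^esub> q) \<leftarrow>\<^bsub>Q\<^esub> d"
    if "q \<in> P" "q' \<in> P" for q q'
    using cyc[of q] that unfolding residuals_def by blast
  let ?t = "(\<top> \<rightarrow>\<^bsub>Q\<^esub> p) \<leftarrow>\<^bsub>Q\<^esub> \<top>"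
  have tQ: "?t \<in> carrier Q"
    by (rule residual_closed)
  have le_t: "x \<sqsubseteq> ?t \<longleftrightarrow> \<top> \<cdot> x \<cdot> \<top> \<sqsubseteq> p" if "x \<in> carrier Q" for x
    using that pQ by (simp add: le_residual)
  have "?t \<noteq> \<top>"
  proof
    assume "?t = \<top>"
    then have ttt: "\<top> \<cdot> \<top> \<cdot> \<top> \<sqsubseteq> p"
      using le_t[of \<top>] by simp
    obtain c d where cd: "c \<in> carrier Q" "d \<in> carrier Q" and pe: "p = (c \<rightarrow>\<^bsub>Q\<^esub> p) \<leftarrow>\<^bsub>Q\<^esub> d"
      using express[OF p p] by blast
    have "p = (c \<cdot> c \<rightarrow>\<^bsub>Q\<^esub> p) \<leftarrow>\<^bsub>Q\<^esub> (d \<cdot> d)"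
      using residual_residual[OF cd cd pQ] pe by simp
    moreover have "d \<cdot> d \<cdot> \<top> \<cdot> (c \<cdot> c) \<sqsubseteq> \<top> \<cdot> \<top> \<cdot> \<top>"
    proof -
      have "d \<cdot> (d \<cdot> \<top> \<cdot> c) \<cdot> c \<sqsubseteq> \<top> \<cdot> \<top> \<cdot> \<top>"
        using cd by (intro mult_mono) (simp_all add: mult_closed)
      then show ?thesis
        using cd by (simp add: mult_closed mult_assoc)
    qed
    then have "d \<cdot> d \<cdot> \<top> \<cdot> (c \<cdot> c) \<sqsubseteq> p"
      using ttt le_trans cd pQ by (meson mult_closed top_closed)
    then have "\<top> \<sqsubseteq> (c \<cdot> c \<rightarrow>\<^bsub>Q\<^esub> p) \<leftarrow>\<^bsub>Q\<^esub> (d \<cdot> d)"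
      using cd pQ by (simp add: le_residual mult_closed)
    ultimately show False
      using top_le_iff[OF pQ] topP p by auto
  qed
  moreover have "?t \<in> P \<union> {\<top>}"
    unfolding cyc[OF p, symmetric] by (simp add: residualsI)
  ultimately have tP: "?t \<in> P"
    by auto
  have in_all: "x \<sqsubseteq> q'" if "q \<in> P" "q' \<in> P" "x \<in> carrier Q" "\<top> \<cdot> x \<cdot> \<top> \<sqsubseteq> q" for q q' x
  proof -
    obtain c d where cd: "c \<in> carrier Q" "d \<in> carrier Q" and q': "q' = (c \<rightarrow>\<^bsub>Q\<^esub> q) \<leftarrow>\<^bsub>Q\<^esub> d"
      using express[OF \<open>q \<in> P\<close> \<open>q' \<in> P\<close>] by blast
    show ?thesis
      unfolding q' by (rule residual_top_mono[OF cd _ that(3,4)]) (use PQ that(1) in blast)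
  qed
  have two: "?t \<in> two_sided Q"
    by (rule residual_top_two_sided[OF pQ])
  have prime: "x \<sqsubseteq> ?t \<or> y \<sqsubseteq> ?t" if "x \<in> carrier Q" "y \<in> carrier Q" "x \<cdot> \<top> \<cdot> y \<sqsubseteq> ?t" for x y
  proof (rule disjCI)
    assume y: "\<not> y \<sqsubseteq> ?t"
    obtain c d where cd: "c \<in> carrier Q" "d \<in> carrier Q" and pe: "p = (c \<rightarrow>\<^bsub>Q\<^esub> p) \<leftarrow>\<^bsub>Q\<^esub> d"
      using express[OF p p] by blast
    \<comment> \<open>This is the one-sided residual \<open>y 1 \<rightarrow> p\<close>: since \<open>p\<close> is its own residual by \<open>c\<close> and \<open>d\<close>,
      multiplying by \<open>c\<close> and \<open>d\<close> as well changes nothing, and the result is visibly in \<open>P\<close>.\<close>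
    let ?q = "((y \<cdot> \<top> \<cdot> c) \<rightarrow>\<^bsub>Q\<^esub> p) \<leftarrow>\<^bsub>Q\<^esub> d"
    have le_q: "z \<sqsubseteq> ?q \<longleftrightarrow> z \<cdot> (y \<cdot> \<top>) \<sqsubseteq> p" if z: "z \<in> carrier Q" for z
    proof -
      have "z \<cdot> (y \<cdot> \<top>) \<sqsubseteq> p \<longleftrightarrow> d \<cdot> (z \<cdot> (y \<cdot> \<top>)) \<cdot> c \<sqsubseteq> p"
        using le_residual[of "z \<cdot> (y \<cdot> \<top>)" c d p] pe cd pQ z \<open>y \<in> carrier Q\<close>
        by (simp add: mult_closed)
      then show ?thesis
        using cd pQ z \<open>y \<in> carrier Q\<close> by (simp add: le_residual mult_closed mult_assoc)
    qed
    have "?q \<noteq> \<top>"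
      using le_q[of \<top>] le_t[of y] y that residual_closed[of _ p d]
      by (simp add: mult_assoc mult_closed) (metis le_refl top_closed)
    moreover have "?q \<in> P \<union> {\<top>}"
      unfolding cyc[OF p, symmetric] using cd that by (simp add: residualsI mult_closed)
    moreover have "\<top> \<cdot> x \<cdot> \<top> \<sqsubseteq> ?q"
      using that le_t[of "x \<cdot> \<top> \<cdot> y"] le_q[of "\<top> \<cdot> x \<cdot> \<top>"] by (simp add: mult_closed mult_assoc)
    ultimately show "x \<sqsubseteq> ?t"
      using in_all[of ?q ?t x] tP that by auto
  qed
  have "?t \<in> two_sided_primes Q"
    using two prime tQ \<open>?t \<noteq> \<top>\<close> by (auto simp: two_sided_primes_def quantale_primes_def)
  moreover have "P = residuals Q ?t - {\<top>}"
    using cyc[OF tP] topP by auto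
  ultimately show thesis
    using that by blast
qed

lemma separating_cyclic_iff:
  "separating Q (\<Union>{P. cyclic_set Q P}) \<longleftrightarrow> prime_residuals_separate Q"
proof
  assume sep: "separating Q (\<Union>{P. cyclic_set Q P})"
  show "prime_residuals_separate Q"
    unfolding prime_residuals_separate_def
  proof (intro ballI impI)
    fix a b assume ab: "a \<in> carrier Q" "b \<in> carrier Q" "\<not> b \<sqsubseteq> a"
    then obtain P p where P: "cyclic_set Q P" "p \<in> P" and p: "a \<sqsubseteq> p" "\<not> b \<sqsubseteq> p"
      using sep unfolding separating_def by blast
    obtain t where t: "t \<in> two_sided_primes Q" "P = residuals Q t - {\<top>}"
      using cyclic_from_prime[OF P(1)] .
    obtain c d where "c \<in> carrier Q" "d \<in> carrier Q" "p = (c \<rightarrow>\<^bsub>Q\<^esub> t) \<leftarrow>\<^bsub>Q\<^esub> d"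
      using P(2) t(2) by (auto simp: residuals_def)
    moreover from this have "d \<cdot> a \<cdot> c \<sqsubseteq> t" "\<not> d \<cdot> b \<cdot> c \<sqsubseteq> t"
      using p ab two_sided_primeD(1)[OF t(1)] by (simp_all add: le_residual)
    ultimately show "\<exists>t \<in> two_sided_primes Q. \<exists>c \<in> carrier Q. \<exists>d \<in> carrier Q.
        d \<cdot> a \<cdot> c \<sqsubseteq> t \<and> \<not> d \<cdot> b \<cdot> c \<sqsubseteq> t"
      using t(1) by (intro bexI conjI)
  qed
next
  assume sep: "prime_residuals_separate Q"
  show "separating Q (\<Union>{P. cyclic_set Q P})"
    unfolding separating_def
  proof (intro ballI impI)
    fix a b assume ab: "a \<in> carrier Q" "b \<in> carrier Q" "\<not> b \<sqsubseteq> a"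
    then obtain t c d where t: "t \<in> two_sided_primes Q" and cd: "c \<in> carrier Q" "d \<in> carrier Q"
      "d \<cdot> a \<cdot> c \<sqsubseteq> t" "\<not> d \<cdot> b \<cdot> c \<sqsubseteq> t"
      using prime_residuals_separateD[OF sep ab] by auto
    let ?p = "(c \<rightarrow>\<^bsub>Q\<^esub> t) \<leftarrow>\<^bsub>Q\<^esub> d"
    have p: "a \<sqsubseteq> ?p" "\<not> b \<sqsubseteq> ?p"
      using ab cd two_sided_primeD(1)[OF t] by (simp_all add: le_residual)
    then have "?p \<in> residuals Q t - {\<top>}"
      using cd ab residualsI by auto
    then show "\<exists>p \<in> \<Union>{P. cyclic_set Q P}. a \<sqsubseteq> p \<and> \<not> b \<sqsubseteq> p"
      using residuals_cyclic[OF t] p by (intro bexI[of _ ?p] UnionI) auto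
  qed
qed

end


section \<open>The quantale of two-sided elements\<close>

context quantale
begin

lemma inf_char:
  assumes "A \<subseteq> carrier Q"
  shows "s = \<Sqinter>A \<longleftrightarrow> s \<in> carrier Q \<and> (\<forall>x \<in> A. s \<sqsubseteq> x) \<and>
    (\<forall>u \<in> carrier Q. (\<forall>x \<in> A. u \<sqsubseteq> x) \<longrightarrow> u \<sqsubseteq> s)" (is "_ \<longleftrightarrow> ?R s")
proof -
  have *: "?R (\<Sqinter>A)"
    using assms inf_lower inf_greatest inf_closed by auto
  moreover have "s = \<Sqinter>A" if "?R s"
    using that * by (intro le_antisym) auto
  ultimately show ?thesis by blast
qed

lemma inf_empty: "\<Sqinter>{} = \<top>"
  by (subst eq_commute, subst inf_char) auto

text \<open>
  Both subquantales that occur, the two-sided elements and the fixed points of a nucleus, are closed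
  under meets, so that their meets and top are those of \<open>Q\<close>.  Their multiplications may differ from
  that of \<open>Q\<close>, hence the parameter \<open>m\<close>.
\<close>

lemma inf_closed_subset:
  fixes F m
  assumes F: "F \<subseteq> carrier Q" and inf: "\<And>A. A \<subseteq> F \<Longrightarrow> \<Sqinter>A \<in> F"
  defines "R \<equiv> Q\<lparr>carrier := F, qmult := m\<rparr>"
  shows "complete_lattice R" "A \<subseteq> F \<Longrightarrow> \<Sqinter>\<^bsub>R\<^esub>A = \<Sqinter>A" "\<top>\<^bsub>R\<^esub> = \<top>"
proof -
  have simps: "carrier R = F" "(.=\<^bsub>R\<^esub>) = (=)" "(\<sqsubseteq>\<^bsub>R\<^esub>) = (\<sqsubseteq>)"
    by (simp_all add: R_def eq_is_equal)
  have FQ: "x \<in> carrier Q" if "x \<in> F" for x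
    using that F by auto
  interpret R: partial_order R
    by unfold_locales (auto simp: simps FQ intro: le_antisym dest: le_trans)
  have glb: "greatest R (\<Sqinter>A) (Lower R A)" if A: "A \<subseteq> F" for A
  proof (rule greatest_LowerI)
    show "y \<sqsubseteq>\<^bsub>R\<^esub> \<Sqinter>A" if "y \<in> Lower R A" for y
      unfolding simps using that A F by (intro inf_greatest) (auto simp: simps Lower_def)
  qed (use A F inf in \<open>auto simp: simps intro!: inf_lower\<close>)
  have topF: "\<top> \<in> F"
    using inf[of "{}"] by (simp add: inf_empty)
  show "complete_lattice R"
  proof (rule R.complete_lattice_criterion1)
    show "\<exists>g. greatest R g (carrier R)"
      using topF F by (auto simp: greatest_def simps intro!: exI[of _ \<top>] top_higher)
  qed (use glb simps in auto)
  then interpret R: complete_lattice R .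
  show "\<Sqinter>\<^bsub>R\<^esub>A = \<Sqinter>A" if "A \<subseteq> F"
    using R.greatest_unique[OF R.inf_glb glb[OF that]] that by (simp add: simps)
  show "\<top>\<^bsub>R\<^esub> = \<top>"
    using R.top_higher[of \<top>] R.top_closed topF F top_le_iff[of "\<top>\<^bsub>R\<^esub>"] by (auto simp: simps)
qed

lemma two_sided_inf:
  assumes "A \<subseteq> two_sided Q"
  shows "\<Sqinter>A \<in> two_sided Q"
proof -
  have A: "A \<subseteq> carrier Q"
    using assms by (auto simp: two_sided_iff)
  have "\<Sqinter>A \<cdot> \<top> \<sqsubseteq> x" "\<top> \<cdot> \<Sqinter>A \<sqsubseteq> x" if "x \<in> A" for x
    using two_sided_mult[of x "\<Sqinter>A" \<top>] assms that A by (auto intro: inf_lower)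
  then show ?thesis
    using A by (auto simp: two_sided_iff mult_closed intro!: inf_greatest)
qed

lemma two_sided_sup:
  assumes "A \<subseteq> two_sided Q"
  shows "\<Squnion>A \<in> two_sided Q"
proof -
  have A: "A \<subseteq> carrier Q"
    using assms by (auto simp: two_sided_iff)
  have "x \<cdot> \<top> \<sqsubseteq> \<Squnion>A" "\<top> \<cdot> x \<sqsubseteq> \<Squnion>A" if "x \<in> A" for x
  proof -
    have x: "x \<in> carrier Q" "x \<cdot> \<top> \<sqsubseteq> x" "\<top> \<cdot> x \<sqsubseteq> x"
      using assms that by (auto simp: two_sided_iff)
    show "x \<cdot> \<top> \<sqsubseteq> \<Squnion>A" "\<top> \<cdot> x \<sqsubseteq> \<Squnion>A"
      using le_trans[OF x(2) sup_upper[OF A that]] le_trans[OF x(3) sup_upper[OF A that]] x(1) A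
      by (simp_all add: mult_closed)
  qed
  then have "\<Squnion>A \<cdot> \<top> \<sqsubseteq> \<Squnion>A" "\<top> \<cdot> \<Squnion>A \<sqsubseteq> \<Squnion>A"
    unfolding mult_sup_left[OF top_closed A] mult_sup_right[OF top_closed A]
    using A by (auto intro!: sup_least simp: subset_iff mult_closed)
  then show ?thesis
    using A by (simp add: two_sided_iff)
qed

lemma two_sided_mult_closed:
  assumes "s \<in> two_sided Q" "t \<in> two_sided Q"
  shows "s \<cdot> t \<in> two_sided Q"
proof -
  have st: "s \<in> carrier Q" "t \<in> carrier Q"
    using assms by (auto simp: two_sided_iff)
  have "s \<cdot> (t \<cdot> \<top>) \<sqsubseteq> s \<cdot> t" "(\<top> \<cdot> s) \<cdot> t \<sqsubseteq> s \<cdot> t"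
    using assms by (auto simp: two_sided_iff mult_closed intro!: mult_mono)
  then show ?thesis
    using st by (simp add: two_sided_iff mult_closed mult_assoc)
qed

lemma two_sided_lattice:
  "complete_lattice (two_sided_quantale Q)"
  "A \<subseteq> two_sided Q \<Longrightarrow> \<Sqinter>\<^bsub>two_sided_quantale Q\<^esub>A = \<Sqinter>A"
  "\<top>\<^bsub>two_sided_quantale Q\<^esub> = \<top>"
proof -
  have T: "two_sided_quantale Q = Q\<lparr>carrier := two_sided Q, qmult := (\<cdot>)\<rparr>"
    by (simp add: two_sided_quantale_def)
  have "two_sided Q \<subseteq> carrier Q"
    by (auto simp: two_sided_iff)
  from inf_closed_subset[OF this two_sided_inf]
  show "complete_lattice (two_sided_quantale Q)"
    "A \<subseteq> two_sided Q \<Longrightarrow> \<Sqinter>\<^bsub>two_sided_quantale Q\<^esub>A = \<Sqinter>A"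
    "\<top>\<^bsub>two_sided_quantale Q\<^esub> = \<top>"
    unfolding T by blast+
qed

lemma two_sided_quantale_simps:
  "carrier (two_sided_quantale Q) = two_sided Q"
  "x \<sqsubseteq>\<^bsub>two_sided_quantale Q\<^esub> y \<longleftrightarrow> x \<sqsubseteq> y"
  "x \<cdot>\<^bsub>two_sided_quantale Q\<^esub> y = x \<cdot> y"
  by (simp_all add: two_sided_quantale_def)

lemma two_sided_quantale_sup:
  assumes A: "A \<subseteq> two_sided Q"
  shows "\<Squnion>\<^bsub>two_sided_quantale Q\<^esub>A = \<Squnion>A"
proof -
  interpret T: complete_lattice "two_sided_quantale Q"
    by (rule two_sided_lattice)
  have A': "A \<subseteq> carrier Q"
    using A by (auto simp: two_sided_iff)
  show ?thesis
    unfolding eq_commute[of _ "\<Squnion>A"] using A two_sided_sup[OF A] sup_upper[OF A'] A'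
    by (subst T.sup_char) (auto simp: two_sided_quantale_simps sup_le_iff two_sided_iff)
qed

lemma quantale_two_sided: "quantale (two_sided_quantale Q)"
proof -
  interpret T: complete_lattice "two_sided_quantale Q"
    by (rule two_sided_lattice)
  have sub: "two_sided Q \<subseteq> carrier Q"
    by (auto simp: two_sided_iff)
  show ?thesis
  proof unfold_locales
    fix a A assume "a \<in> carrier (two_sided_quantale Q)" "A \<subseteq> carrier (two_sided_quantale Q)"
    then have a: "a \<in> two_sided Q" and A: "A \<subseteq> two_sided Q"
      by (simp_all add: two_sided_quantale_simps)
    have img: "(\<lambda>x. a \<cdot> x) ` A \<subseteq> two_sided Q" "(\<lambda>x. x \<cdot> a) ` A \<subseteq> two_sided Q"
      using a A two_sided_mult_closed by auto
    have "a \<in> carrier Q" "A \<subseteq> carrier Q"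
      using a A sub by auto
    then show "a \<cdot>\<^bsub>two_sided_quantale Q\<^esub> (\<Squnion>\<^bsub>two_sided_quantale Q\<^esub>A) =
        \<Squnion>\<^bsub>two_sided_quantale Q\<^esub>((\<lambda>x. a \<cdot>\<^bsub>two_sided_quantale Q\<^esub> x) ` A)"
      "(\<Squnion>\<^bsub>two_sided_quantale Q\<^esub>A) \<cdot>\<^bsub>two_sided_quantale Q\<^esub> a =
        \<Squnion>\<^bsub>two_sided_quantale Q\<^esub>((\<lambda>x. x \<cdot>\<^bsub>two_sided_quantale Q\<^esub> a) ` A)"
      using A img
      by (simp_all add: two_sided_quantale_simps two_sided_quantale_sup mult_sup_left mult_sup_right)
  qed (use sub in \<open>auto simp: two_sided_quantale_simps two_sided_mult_closed mult_assoc subset_iff\<close>)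
qed

lemma two_sided_meet:
  assumes "u \<in> two_sided Q" "v \<in> two_sided Q"
  shows "u \<sqinter>\<^bsub>two_sided_quantale Q\<^esub> v = u \<sqinter> v"
  using assms two_sided_lattice(2)[of "{u, v}"] by (simp add: meet_def)


section \<open>Spatiality and strict faithfulness\<close>

text \<open>
  A separating triple \<open>t, c, d\<close> can be replaced by \<open>t, c 1, 1 d\<close>, by primeness of \<open>t\<close>.
\<close>

lemma prime_separation_strictly_faithful:
  assumes "prime_residuals_separate Q"
  shows "strictly_faithful Q"
proof -
  have le: "b \<sqsubseteq> a" if ab: "a \<in> carrier Q" "b \<in> carrier Q"
    and eq: "\<And>l r. \<lbrakk>l \<in> left_sided Q; r \<in> right_sided Q\<rbrakk> \<Longrightarrow> l \<cdot> a \<cdot> r = l \<cdot> b \<cdot> r" for a b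
  proof (rule ccontr)
    assume "\<not> b \<sqsubseteq> a"
    then obtain t c d where t: "t \<in> two_sided_primes Q" and cd: "c \<in> carrier Q" "d \<in> carrier Q"
      and dc: "d \<cdot> a \<cdot> c \<sqsubseteq> t" "\<not> d \<cdot> b \<cdot> c \<sqsubseteq> t"
      using prime_residuals_separateD[OF assms ab] by auto
    have "(\<top> \<cdot> \<top>) \<cdot> d \<sqsubseteq> \<top> \<cdot> d" "c \<cdot> (\<top> \<cdot> \<top>) \<sqsubseteq> c \<cdot> \<top>"
      using cd by (auto intro!: mult_mono simp: mult_closed)
    then have "\<top> \<cdot> d \<in> left_sided Q" "c \<cdot> \<top> \<in> right_sided Q"
      using cd by (simp_all add: left_sided_def right_sided_def mult_closed mult_assoc)
    then have "(\<top> \<cdot> d) \<cdot> a \<cdot> (c \<cdot> \<top>) = (\<top> \<cdot> d) \<cdot> b \<cdot> (c \<cdot> \<top>)"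
      by (rule eq)
    then have "\<top> \<cdot> (d \<cdot> a \<cdot> c) \<cdot> \<top> = \<top> \<cdot> (d \<cdot> b \<cdot> c) \<cdot> \<top>"
      using ab cd by (simp add: mult_closed mult_assoc)
    then show False
      using dc prime_sandwich[OF t] ab cd by (metis mult_closed)
  qed
  show ?thesis
    unfolding strictly_faithful_def using le by (intro ballI impI le_antisym) auto
qed

text \<open>
  From \<open>(d x) 1 (y c) \<le> t\<close> one of the two factors is below \<open>t\<close>, and multiplying it by the missing
  \<open>c\<close> or \<open>d\<close> keeps it there.
\<close>

lemma residual_prime:
  assumes t: "t \<in> two_sided_primes Q" and cd: "c \<in> carrier Q" "d \<in> carrier Q"
  shows "(c \<rightarrow>\<^bsub>Q\<^esub> t) \<leftarrow>\<^bsub>Q\<^esub> d \<in> quantale_primes Q"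
  unfolding quantale_primes_def
proof (intro CollectI conjI ballI impI)
  note tD = two_sided_primeD[OF t] and tM = two_sided_mult[OF two_sided_primeD(2)[OF t]]
  fix x y assume xy: "x \<in> carrier Q" "y \<in> carrier Q"
    and "x \<cdot> \<top> \<cdot> y \<sqsubseteq> (c \<rightarrow>\<^bsub>Q\<^esub> t) \<leftarrow>\<^bsub>Q\<^esub> d"
  then have "d \<cdot> (x \<cdot> \<top> \<cdot> y) \<cdot> c \<sqsubseteq> t"
    using cd tD(1) by (simp add: le_residual mult_closed)
  then have "(d \<cdot> x) \<cdot> \<top> \<cdot> (y \<cdot> c) \<sqsubseteq> t"
    using cd xy by (simp add: mult_closed mult_assoc)
  then have "d \<cdot> x \<sqsubseteq> t \<or> y \<cdot> c \<sqsubseteq> t"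
    using tD(4)[of "d \<cdot> x" "y \<cdot> c"] cd xy by (simp add: mult_closed)
  then have "(d \<cdot> x) \<cdot> c \<sqsubseteq> t \<or> d \<cdot> (y \<cdot> c) \<sqsubseteq> t"
    using tM cd xy by (auto simp: mult_closed)
  then show "x \<sqsubseteq> (c \<rightarrow>\<^bsub>Q\<^esub> t) \<leftarrow>\<^bsub>Q\<^esub> d \<or> y \<sqsubseteq> (c \<rightarrow>\<^bsub>Q\<^esub> t) \<leftarrow>\<^bsub>Q\<^esub> d"
    using cd xy tD(1) by (simp add: le_residual mult_assoc)
qed (rule residual_closed)

lemma prime_separation_spatial:
  assumes "prime_residuals_separate Q"
  shows "spatial_quantale Q"
  unfolding spatial_quantale_def
proof
  fix a assume a: "a \<in> carrier Q"
  let ?P = "{p \<in> quantale_primes Q. a \<sqsubseteq> p}"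
  have P: "?P \<subseteq> carrier Q"
    by (auto simp: quantale_primes_def)
  have "\<Sqinter>?P \<sqsubseteq> a"
  proof (rule ccontr)
    assume "\<not> \<Sqinter>?P \<sqsubseteq> a"
    then obtain t c d where t: "t \<in> two_sided_primes Q" and cd: "c \<in> carrier Q" "d \<in> carrier Q"
      and dc: "d \<cdot> a \<cdot> c \<sqsubseteq> t" "\<not> d \<cdot> (\<Sqinter>?P) \<cdot> c \<sqsubseteq> t"
      using prime_residuals_separateD[OF assms a inf_closed[OF P]] by auto
    have "(c \<rightarrow>\<^bsub>Q\<^esub> t) \<leftarrow>\<^bsub>Q\<^esub> d \<in> ?P"
      using residual_prime[OF t cd] dc a cd two_sided_primeD(1)[OF t] by (simp add: le_residual)
    then have "\<Sqinter>?P \<sqsubseteq> (c \<rightarrow>\<^bsub>Q\<^esub> t) \<leftarrow>\<^bsub>Q\<^esub> d"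
      by (rule inf_lower[OF P])
    then show False
      using dc cd two_sided_primeD(1)[OF t] inf_closed[OF P] by (simp add: le_residual)
  qed
  moreover have "a \<sqsubseteq> \<Sqinter>?P"
    using P a by (intro inf_greatest) auto
  ultimately have "a = \<Sqinter>?P"
    using a P by (intro le_antisym) auto
  then show "\<exists>P \<subseteq> quantale_primes Q. a = \<Sqinter>P"
    by (intro exI[of _ ?P]) auto
qed

lemma quantale_primeD:
  "\<lbrakk>p \<in> quantale_primes Q; a \<in> carrier Q; b \<in> carrier Q; a \<cdot> \<top> \<cdot> b \<sqsubseteq> p\<rbrakk> \<Longrightarrow> a \<sqsubseteq> p \<or> b \<sqsubseteq> p"
  by (simp add: quantale_primes_def)

lemma two_sided_mult_le:
  assumes "u \<in> two_sided Q" "v \<in> two_sided Q"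
  shows "u \<cdot> v \<sqsubseteq> u \<sqinter> v"
  using two_sided_mult[of u u v] two_sided_mult[of v v u] assms
  by (intro meet_le) (auto simp: two_sided_iff mult_closed)

text \<open>
  Two-sided elements are idempotent, since \<open>w 1 w \<le> w w\<close> and \<open>w w\<close> is a meet of primes; hence their
  product is their meet.  For each prime \<open>p \<noteq> 1\<close> of \<open>Q\<close>, the largest two-sided element below \<open>p\<close> is
  a prime of the locale, and a two-sided element is below it as soon as it is below \<open>p\<close>.
\<close>

lemma spatial_two_sided_locale:
  assumes sp: "spatial_quantale Q"
  shows "spatial_locale (two_sided_quantale Q)"
proof -
  let ?T = "two_sided_quantale Q"
  have sub: "two_sided Q \<subseteq> carrier Q"
    by (auto simp: two_sided_iff)
  have idem: "w \<sqsubseteq> w \<cdot> w" if w: "w \<in> two_sided Q" for w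
  proof -
    have wQ: "w \<in> carrier Q"
      using w by (auto simp: two_sided_iff)
    obtain P where P: "P \<subseteq> quantale_primes Q" and ww: "w \<cdot> w = \<Sqinter>P"
      using sp wQ mult_closed unfolding spatial_quantale_def by meson
    have PQ: "P \<subseteq> carrier Q"
      using P by (auto simp: quantale_primes_def)
    have "w \<sqsubseteq> p" if p: "p \<in> P" for p
    proof -
      have pQ: "p \<in> carrier Q"
        using p PQ by auto
      have "w \<cdot> \<top> \<cdot> w \<sqsubseteq> w \<cdot> w"
        using w wQ by (intro mult_mono) (auto simp: two_sided_iff mult_closed)
      moreover have "w \<cdot> w \<sqsubseteq> p"
        unfolding ww using PQ p by (rule inf_lower)
      ultimately have "w \<cdot> \<top> \<cdot> w \<sqsubseteq> p"
        using wQ pQ le_trans[of "w \<cdot> \<top> \<cdot> w" "w \<cdot> w" p] by (simp add: mult_closed)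
      then show ?thesis
        using quantale_primeD[of p w w] P p wQ by auto
    qed
    then show ?thesis
      unfolding ww using PQ wQ by (intro inf_greatest)
  qed
  have meet: "u \<sqinter> v \<in> two_sided Q" "u \<cdot> v = u \<sqinter> v" if uv: "u \<in> two_sided Q" "v \<in> two_sided Q" for u v
  proof -
    let ?w = "u \<sqinter> v"
    have uvQ: "u \<in> carrier Q" "v \<in> carrier Q"
      using uv sub by auto
    show w: "?w \<in> two_sided Q"
      using two_sided_inf[of "{u, v}"] uv by (simp add: meet_def)
    have "?w \<cdot> ?w \<sqsubseteq> u \<cdot> v"
      using uvQ by (intro mult_mono) (auto intro: meet_left meet_right)
    then have "?w \<sqsubseteq> u \<cdot> v"
      using idem[OF w] uvQ le_trans[of ?w "?w \<cdot> ?w" "u \<cdot> v"] by (simp add: mult_closed)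
    then show "u \<cdot> v = ?w"
      using two_sided_mult_le[OF uv] uvQ by (intro le_antisym) (auto simp: mult_closed)
  qed
  have "is_locale ?T"
    using quantale_two_sided meet(2)
    by (simp add: is_locale_def two_sided_quantale_simps two_sided_meet)
  moreover have "\<exists>P \<subseteq> locale_primes ?T. a = \<Sqinter>\<^bsub>?T\<^esub>P" if "a \<in> two_sided Q" for a
  proof -
    have aQ: "a \<in> carrier Q"
      using that sub by auto
    let ?P = "{p \<in> locale_primes ?T. a \<sqsubseteq> p}"
    have P: "?P \<subseteq> two_sided Q"
      by (auto simp: locale_primes_def two_sided_quantale_simps)
    then have PQ: "?P \<subseteq> carrier Q"
      using sub by auto
    obtain A where A: "A \<subseteq> quantale_primes Q" and a: "a = \<Sqinter>A"
      using sp aQ by (auto simp: spatial_quantale_def)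
    have AQ: "A \<subseteq> carrier Q"
      using A by (auto simp: quantale_primes_def)
    have "\<Sqinter>?P \<sqsubseteq> p" if p: "p \<in> A" for p
    proof (cases "p = \<top>")
      case False
      have pQ: "p \<in> carrier Q"
        using p AQ by auto
      \<comment> \<open>The join of this set is the largest two-sided element below \<open>p\<close>.\<close>
      let ?S = "{t \<in> two_sided Q. t \<sqsubseteq> p}"
      have S: "?S \<subseteq> two_sided Q" "?S \<subseteq> carrier Q"
        using sub by auto
      have Sp: "\<Squnion>?S \<sqsubseteq> p"
        using S pQ by (intro sup_least) auto
      have "\<Squnion>?S \<in> locale_primes ?T"
      proof -
        have "\<Squnion>?S \<noteq> \<top>"
          using False Sp pQ by (auto simp: top_le_iff)
        moreover have "u \<sqsubseteq> \<Squnion>?S \<or> v \<sqsubseteq> \<Squnion>?S"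
          if uv: "u \<in> two_sided Q" "v \<in> two_sided Q" "u \<sqinter> v \<sqsubseteq> \<Squnion>?S" for u v
        proof -
          have uvQ: "u \<in> carrier Q" "v \<in> carrier Q"
            using uv sub by auto
          have "u \<cdot> \<top> \<cdot> v \<sqsubseteq> u \<cdot> v"
            using uv by (intro mult_mono) (auto simp: two_sided_iff mult_closed)
          moreover have "u \<cdot> v \<sqsubseteq> p"
            using uv(3) Sp pQ S(2) uvQ meet(2)[OF uv(1,2)] le_trans[of "u \<sqinter> v" "\<Squnion>?S" p] by simp
          ultimately have "u \<cdot> \<top> \<cdot> v \<sqsubseteq> p"
            using pQ uvQ le_trans[of "u \<cdot> \<top> \<cdot> v" "u \<cdot> v" p] by (simp add: mult_closed)
          then have "u \<sqsubseteq> p \<or> v \<sqsubseteq> p"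
            using quantale_primeD[of p u v] A p uvQ by auto
          then show ?thesis
            using uv S by (auto intro: sup_upper)
        qed
        ultimately show ?thesis
          using two_sided_sup[OF S(1)]
          by (simp add: locale_primes_def two_sided_quantale_simps two_sided_meet two_sided_lattice(3))
      qed
      moreover have "a \<sqsubseteq> \<Squnion>?S"
        using \<open>a \<in> two_sided Q\<close> inf_lower[OF AQ p] by (intro sup_upper[OF S(2)]) (simp add: a)
      ultimately have "\<Sqinter>?P \<sqsubseteq> \<Squnion>?S"
        by (intro inf_lower[OF PQ]) auto
      then show ?thesis
        using Sp pQ PQ S(2) le_trans[of "\<Sqinter>?P" "\<Squnion>?S" p] by simp
    qed (use PQ in \<open>simp add: top_higher\<close>)
    then have "\<Sqinter>?P \<sqsubseteq> a"
      unfolding a using AQ PQ a by (intro inf_greatest) auto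
    moreover have "a \<sqsubseteq> \<Sqinter>?P"
      using PQ aQ by (intro inf_greatest) auto
    ultimately have "a = \<Sqinter>?P"
      using aQ PQ by (intro le_antisym) auto
    then show ?thesis
      using two_sided_lattice(2)[OF P] by (intro exI[of _ ?P]) auto
  qed
  ultimately show ?thesis
    by (simp add: spatial_locale_def two_sided_quantale_simps)
qed

text \<open>
  Primeness among two-sided elements passes from \<open>1 a 1\<close> and \<open>1 b 1\<close> to \<open>a\<close> and \<open>b\<close> because
  \<open>1 x 1 \<le> p\<close> implies \<open>x \<le> p\<close>: the largest such \<open>x\<close> is two-sided, hence idempotent, hence below
  \<open>1 x 1\<close>.
\<close>

lemma locale_prime_two_sided_prime:
  assumes loc: "is_locale (two_sided_quantale Q)" and p: "p \<in> locale_primes (two_sided_quantale Q)"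
  shows "p \<in> two_sided_primes Q"
proof -
  have p2: "p \<in> two_sided Q" and ptop: "p \<noteq> \<top>"
    and prime: "\<And>u v. \<lbrakk>u \<in> two_sided Q; v \<in> two_sided Q; u \<sqinter> v \<sqsubseteq> p\<rbrakk> \<Longrightarrow> u \<sqsubseteq> p \<or> v \<sqsubseteq> p"
    using p by (auto simp: locale_primes_def two_sided_quantale_simps two_sided_lattice(3) two_sided_meet)
  have mult: "u \<cdot> v = u \<sqinter> v" if "u \<in> two_sided Q" "v \<in> two_sided Q" for u v
    using loc that by (simp add: is_locale_def two_sided_quantale_simps two_sided_meet)
  have sub: "two_sided Q \<subseteq> carrier Q"
    by (auto simp: two_sided_iff)
  have pQ: "p \<in> carrier Q"
    using p2 sub by auto
  have le_p: "x \<sqsubseteq> p" if x: "x \<in> carrier Q" and xp: "\<top> \<cdot> x \<cdot> \<top> \<sqsubseteq> p" for x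
  proof -
    let ?y = "(\<top> \<rightarrow>\<^bsub>Q\<^esub> p) \<leftarrow>\<^bsub>Q\<^esub> \<top>"
    have y2: "?y \<in> two_sided Q"
      by (rule residual_top_two_sided[OF pQ])
    then have y: "?y \<in> carrier Q"
      using sub by auto
    have "?y \<cdot> ?y = ?y"
      using mult[OF y2 y2] y by (simp add: meet_def)
    then have "?y \<cdot> ?y \<cdot> ?y = ?y"
      by simp
    moreover have "?y \<cdot> ?y \<cdot> ?y \<sqsubseteq> \<top> \<cdot> ?y \<cdot> \<top>"
      by (rule sandwich_le_top[OF y y y])
    moreover have "\<top> \<cdot> ?y \<cdot> \<top> \<sqsubseteq> p"
      using le_residual[of ?y \<top> \<top> p] y pQ by simp
    ultimately have "?y \<sqsubseteq> p"
      using le_trans[of ?y "\<top> \<cdot> ?y \<cdot> \<top>" p] y pQ by (simp add: mult_closed)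
    moreover have "x \<sqsubseteq> ?y"
      using x xp pQ by (simp add: le_residual)
    ultimately show ?thesis
      using le_trans[of x ?y p] x y pQ by simp
  qed
  have "a \<sqsubseteq> p \<or> b \<sqsubseteq> p" if ab: "a \<in> carrier Q" "b \<in> carrier Q" "a \<cdot> \<top> \<cdot> b \<sqsubseteq> p" for a b
  proof -
    have "(\<top> \<cdot> a) \<cdot> (\<top> \<cdot> \<top>) \<cdot> (b \<cdot> \<top>) \<sqsubseteq> (\<top> \<cdot> a) \<cdot> \<top> \<cdot> (b \<cdot> \<top>)"
      using ab by (intro mult_mono) (auto simp: mult_closed)
    then have "(\<top> \<cdot> a \<cdot> \<top>) \<cdot> (\<top> \<cdot> b \<cdot> \<top>) \<sqsubseteq> \<top> \<cdot> (a \<cdot> \<top> \<cdot> b) \<cdot> \<top>"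
      using ab by (simp add: mult_closed mult_assoc)
    moreover have "\<top> \<cdot> (a \<cdot> \<top> \<cdot> b) \<cdot> \<top> \<sqsubseteq> p"
      using two_sided_mult[OF p2] ab by (simp add: mult_closed)
    ultimately have "(\<top> \<cdot> a \<cdot> \<top>) \<cdot> (\<top> \<cdot> b \<cdot> \<top>) \<sqsubseteq> p"
      using le_trans[of "(\<top> \<cdot> a \<cdot> \<top>) \<cdot> (\<top> \<cdot> b \<cdot> \<top>)"] ab pQ by (simp add: mult_closed)
    then have "\<top> \<cdot> a \<cdot> \<top> \<sqsubseteq> p \<or> \<top> \<cdot> b \<cdot> \<top> \<sqsubseteq> p"
      using prime mult sandwich_two_sided ab by simp
    then show ?thesis
      using le_p ab by auto
  qed
  then show ?thesis
    using p2 ptop pQ by (auto simp: two_sided_primes_def quantale_primes_def)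
qed

text \<open>
  Strict faithfulness is applied to \<open>a\<close> and \<open>a \<squnion> b\<close>, since it yields only an inequality
  \<open>l a r \<noteq> l (a \<squnion> b) r\<close>, which for this pair says that \<open>l b r\<close> is not below \<open>l a r\<close>.
\<close>

lemma spatial_locale_prime_separation:
  assumes sf: "strictly_faithful Q" and sp: "spatial_locale (two_sided_quantale Q)"
  shows "prime_residuals_separate Q"
  unfolding prime_residuals_separate_def
proof (intro ballI impI)
  fix a b assume ab: "a \<in> carrier Q" "b \<in> carrier Q" "\<not> b \<sqsubseteq> a"
  have "a \<squnion> b \<noteq> a"
    using ab join_right[of a b] by auto
  then obtain l r where l: "l \<in> left_sided Q" and r: "r \<in> right_sided Q"
    and lr: "l \<cdot> (a \<squnion> b) \<cdot> r \<noteq> l \<cdot> a \<cdot> r"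
    using sf ab join_closed[OF ab(1,2)] unfolding strictly_faithful_def by metis
  have lrQ: "l \<in> carrier Q" "r \<in> carrier Q" "\<top> \<cdot> l \<sqsubseteq> l" "r \<cdot> \<top> \<sqsubseteq> r"
    using l r by (auto simp: left_sided_def right_sided_def)
  have two: "l \<cdot> x \<cdot> r \<in> two_sided Q" if x: "x \<in> carrier Q" for x
  proof -
    have "(\<top> \<cdot> l) \<cdot> (x \<cdot> r) \<sqsubseteq> l \<cdot> (x \<cdot> r)" "(l \<cdot> x) \<cdot> (r \<cdot> \<top>) \<sqsubseteq> (l \<cdot> x) \<cdot> r"
      using lrQ x by (auto intro!: mult_mono simp: mult_closed)
    then show ?thesis
      using lrQ x by (simp add: two_sided_iff mult_closed mult_assoc)
  qed
  have "l \<cdot> (a \<squnion> b) \<cdot> r = \<Squnion>{l \<cdot> a \<cdot> r, l \<cdot> b \<cdot> r}"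
    using mult_sup_right[of l "{a, b}"] mult_sup_left[of r "{l \<cdot> a, l \<cdot> b}"] ab lrQ
    by (simp add: join_def mult_closed)
  then have no: "\<not> l \<cdot> b \<cdot> r \<sqsubseteq> l \<cdot> a \<cdot> r"
    using lr sup_pair[of "l \<cdot> b \<cdot> r" "l \<cdot> a \<cdot> r"] ab lrQ by (auto simp: mult_closed insert_commute)
  obtain P where P: "P \<subseteq> locale_primes (two_sided_quantale Q)"
    and "l \<cdot> a \<cdot> r = \<Sqinter>\<^bsub>two_sided_quantale Q\<^esub>P"
    using sp two[OF ab(1)] by (auto simp: spatial_locale_def two_sided_quantale_simps)
  moreover have P2: "P \<subseteq> two_sided Q"
    using P by (auto simp: locale_primes_def two_sided_quantale_simps)
  ultimately have lar: "l \<cdot> a \<cdot> r = \<Sqinter>P"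
    using two_sided_lattice(2) by simp
  have PQ: "P \<subseteq> carrier Q"
    using P2 by (auto simp: two_sided_iff)
  obtain t where t: "t \<in> P" "\<not> l \<cdot> b \<cdot> r \<sqsubseteq> t"
    using no inf_greatest[OF PQ, of "l \<cdot> b \<cdot> r"] ab lrQ unfolding lar by (auto simp: mult_closed)
  have "is_locale (two_sided_quantale Q)"
    using sp by (simp add: spatial_locale_def)
  then have "t \<in> two_sided_primes Q"
    using locale_prime_two_sided_prime P t(1) by auto
  moreover have "l \<cdot> a \<cdot> r \<sqsubseteq> t"
    unfolding lar using PQ t(1) by (rule inf_lower)
  ultimately show "\<exists>t \<in> two_sided_primes Q. \<exists>c \<in> carrier Q. \<exists>d \<in> carrier Q.
      d \<cdot> a \<cdot> c \<sqsubseteq> t \<and> \<not> d \<cdot> b \<cdot> c \<sqsubseteq> t"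
    using t(2) lrQ by (intro bexI conjI)
qed

end


section \<open>Surjective morphisms\<close>

lemma hom_mono:
  assumes Q: "quantale Q" and R: "quantale R" and f: "f \<in> quantale_hom Q R"
    and xy: "x \<in> carrier Q" "y \<in> carrier Q" "x \<sqsubseteq>\<^bsub>Q\<^esub> y"
  shows "f x \<sqsubseteq>\<^bsub>R\<^esub> f y"
proof -
  interpret Q: quantale Q by (rule Q)
  interpret R: quantale R by (rule R)
  have "f y = \<Squnion>\<^bsub>R\<^esub>{f x, f y}"
    using quantale_homD(2)[OF f, of "{x, y}"] xy by (simp add: Q.sup_pair)
  then show ?thesis
    using R.sup_upper[of "{f x, f y}" "f x"] quantale_homD(1)[OF f] xy by simp
qed

lemma epi_bounds:
  assumes Q: "quantale Q" and R: "quantale R" and f: "f \<in> quantale_epi Q R"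
  shows "f \<bottom>\<^bsub>Q\<^esub> = \<bottom>\<^bsub>R\<^esub>" "f \<top>\<^bsub>Q\<^esub> = \<top>\<^bsub>R\<^esub>"
proof -
  interpret Q: quantale Q by (rule Q)
  interpret R: quantale R by (rule R)
  have h: "f \<in> quantale_hom Q R" "f ` carrier Q = carrier R"
    using f by (auto simp: quantale_epi_def)
  show "f \<bottom>\<^bsub>Q\<^esub> = \<bottom>\<^bsub>R\<^esub>"
    using quantale_homD(2)[OF h(1), of "{}"] by (simp add: Q.bot_eq_sup R.bot_eq_sup)
  show "f \<top>\<^bsub>Q\<^esub> = \<top>\<^bsub>R\<^esub>"
    using quantale_homD(2)[OF h(1), of "carrier Q"] h(2) by (simp add: Q.top_eq_sup R.top_eq_sup)
qed

lemma injective_epi_iso: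
  assumes Q: "quantale Q" and f: "f \<in> quantale_epi Q R" and inj: "inj_on f (carrier Q)"
  shows "f \<in> quantale_iso Q R"
proof -
  interpret Q: quantale Q by (rule Q)
  let ?g = "inv_into (carrier Q) f"
  have h: "f \<in> quantale_hom Q R" and img: "f ` carrier Q = carrier R"
    using f by (auto simp: quantale_epi_def)
  have gf: "?g (f x) = x" if "x \<in> carrier Q" for x
    using inj that by (rule inv_into_f_f)
  have fg: "f (?g y) = y" "?g y \<in> carrier Q" if "y \<in> carrier R" for y
    using that img by (auto simp: f_inv_into_f inv_into_into)
  have "?g \<in> quantale_hom R Q"
  proof (rule quantale_homI)
    fix A assume "A \<subseteq> carrier R"
    then obtain B where B: "B \<subseteq> carrier Q" "A = f ` B"
      using img by (metis subset_imageE)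
    then have "?g ` A = B"
      using inj by (simp add: inv_into_image_cancel)
    then show "?g (\<Squnion>\<^bsub>R\<^esub>A) = \<Squnion>\<^bsub>Q\<^esub>(?g ` A)"
      using B gf[of "\<Squnion>\<^bsub>Q\<^esub>B"] quantale_homD(2)[OF h B(1)] by simp
  next
    fix x y assume xy: "x \<in> carrier R" "y \<in> carrier R"
    have "f (?g x \<cdot>\<^bsub>Q\<^esub> ?g y) = x \<cdot>\<^bsub>R\<^esub> y"
      using quantale_homD(3)[OF h, of "?g x" "?g y"] fg xy by simp
    then show "?g (x \<cdot>\<^bsub>R\<^esub> y) = ?g x \<cdot>\<^bsub>Q\<^esub> ?g y"
      using gf[of "?g x \<cdot>\<^bsub>Q\<^esub> ?g y"] fg xy Q.mult_closed by simp
  qed (rule fg)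
  then show ?thesis
    using h gf fg by (auto simp: quantale_iso_def)
qed

text \<open>
  Every value lies between the values at bottom and top.
\<close>

lemma epi_constant:
  assumes Q: "quantale Q" and R: "quantale R" and f: "f \<in> quantale_epi Q R"
    and eq: "f \<top>\<^bsub>Q\<^esub> = f \<bottom>\<^bsub>Q\<^esub>"
  shows "\<exists>z. carrier R = {z} \<and> (\<forall>x \<in> carrier Q. f x = z)"
proof -
  interpret Q: quantale Q by (rule Q)
  interpret R: quantale R by (rule R)
  have h: "f \<in> quantale_hom Q R" and img: "f ` carrier Q = carrier R"
    using f by (auto simp: quantale_epi_def)
  have "f x = f \<top>\<^bsub>Q\<^esub>" if x: "x \<in> carrier Q" for x
  proof (rule R.le_antisym)
    show "f x \<sqsubseteq>\<^bsub>R\<^esub> f \<top>\<^bsub>Q\<^esub>"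
      using x by (intro hom_mono[OF Q R h]) (simp_all add: Q.top_higher)
    show "f \<top>\<^bsub>Q\<^esub> \<sqsubseteq>\<^bsub>R\<^esub> f x"
      unfolding eq using x by (intro hom_mono[OF Q R h]) simp_all
  qed (use x quantale_homD(1)[OF h] in simp_all)
  then have const: "\<forall>x \<in> carrier Q. f x = f \<top>\<^bsub>Q\<^esub>"
    by blast
  then have "f ` carrier Q = (\<lambda>_. f \<top>\<^bsub>Q\<^esub>) ` carrier Q"
    by (intro image_cong refl) blast
  then have "carrier R = {f \<top>\<^bsub>Q\<^esub>}"
    unfolding img using image_constant[OF Q.top_closed] by simp
  then show ?thesis
    using const by blast
qed


section \<open>Nuclei\<close>

text \<open>A closure operator that is lax multiplicative.  Monotonicity and idempotence are both
  contained in the clause on \<open>x \<le> j y\<close>.\<close>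

definition nucleus :: "'a quantale_struct \<Rightarrow> ('a \<Rightarrow> 'a) \<Rightarrow> bool" where
  "nucleus Q j \<longleftrightarrow> (\<forall>x \<in> carrier Q. j x \<in> carrier Q \<and> x \<sqsubseteq>\<^bsub>Q\<^esub> j x) \<and>
     (\<forall>x \<in> carrier Q. \<forall>y \<in> carrier Q. (x \<sqsubseteq>\<^bsub>Q\<^esub> j y \<longrightarrow> j x \<sqsubseteq>\<^bsub>Q\<^esub> j y) \<and>
        j x \<cdot>\<^bsub>Q\<^esub> j y \<sqsubseteq>\<^bsub>Q\<^esub> j (x \<cdot>\<^bsub>Q\<^esub> y))"

text \<open>The fixed points of \<open>j\<close>, which carry the quotient of \<open>Q\<close> by the congruence \<open>j x = j y\<close>.\<close>

definition nucleus_quotient :: "'a quantale_struct \<Rightarrow> ('a \<Rightarrow> 'a) \<Rightarrow> 'a quantale_struct" where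
  "nucleus_quotient Q j =
     Q\<lparr>carrier := {x \<in> carrier Q. j x = x}, qmult := \<lambda>x y. j (x \<cdot>\<^bsub>Q\<^esub> y)\<rparr>"

lemma nucleus_quotient_simps:
  "carrier (nucleus_quotient Q j) = {x \<in> carrier Q. j x = x}"
  "x \<sqsubseteq>\<^bsub>nucleus_quotient Q j\<^esub> y \<longleftrightarrow> x \<sqsubseteq>\<^bsub>Q\<^esub> y"
  "x \<cdot>\<^bsub>nucleus_quotient Q j\<^esub> y = j (x \<cdot>\<^bsub>Q\<^esub> y)"
  by (simp_all add: nucleus_quotient_def)

context quantale
begin

context
  fixes j
  assumes nuc: "nucleus Q j"
begin

lemma nucleus_closed: "x \<in> carrier Q \<Longrightarrow> j x \<in> carrier Q"
  and nucleus_le: "x \<in> carrier Q \<Longrightarrow> x \<sqsubseteq> j x"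
  and nucleus_least: "\<lbrakk>x \<in> carrier Q; y \<in> carrier Q; x \<sqsubseteq> j y\<rbrakk> \<Longrightarrow> j x \<sqsubseteq> j y"
  and nucleus_mult_le: "\<lbrakk>x \<in> carrier Q; y \<in> carrier Q\<rbrakk> \<Longrightarrow> j x \<cdot> j y \<sqsubseteq> j (x \<cdot> y)"
  using nuc by (simp_all add: nucleus_def)

lemma nucleus_idem:
  assumes "x \<in> carrier Q"
  shows "j (j x) = j x"
  using assms nucleus_least[of "j x" x] nucleus_le[of "j x"]
  by (intro le_antisym) (auto simp: nucleus_closed)

lemma nucleus_mono:
  assumes "x \<in> carrier Q" "y \<in> carrier Q" "x \<sqsubseteq> y"
  shows "j x \<sqsubseteq> j y"
  using assms le_trans[OF assms(3) nucleus_le[OF assms(2)]] nucleus_least[of x y]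
  by (simp add: nucleus_closed)

lemma nucleus_mult:
  assumes xy: "x \<in> carrier Q" "y \<in> carrier Q"
  shows "j (j x \<cdot> y) = j (x \<cdot> y)" "j (x \<cdot> j y) = j (x \<cdot> y)"
proof -
  have c: "j x \<in> carrier Q" "j y \<in> carrier Q"
    using xy by (simp_all add: nucleus_closed)
  have "j x \<cdot> y \<sqsubseteq> j x \<cdot> j y" "x \<cdot> j y \<sqsubseteq> j x \<cdot> j y"
    using xy c by (auto intro!: mult_mono nucleus_le)
  then have "j x \<cdot> y \<sqsubseteq> j (x \<cdot> y)" "x \<cdot> j y \<sqsubseteq> j (x \<cdot> y)"
    using le_trans[OF _ nucleus_mult_le[OF xy]] xy c by (simp_all add: mult_closed nucleus_closed)
  then have "j (j x \<cdot> y) \<sqsubseteq> j (x \<cdot> y)" "j (x \<cdot> j y) \<sqsubseteq> j (x \<cdot> y)"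
    using xy c by (auto intro!: nucleus_least simp: mult_closed)
  moreover have "j (x \<cdot> y) \<sqsubseteq> j (j x \<cdot> y)" "j (x \<cdot> y) \<sqsubseteq> j (x \<cdot> j y)"
    using xy c by (auto intro!: nucleus_mono mult_mono nucleus_le simp: mult_closed)
  ultimately show "j (j x \<cdot> y) = j (x \<cdot> y)" "j (x \<cdot> j y) = j (x \<cdot> y)"
    using xy c by (auto intro!: le_antisym simp: mult_closed nucleus_closed)
qed

lemma nucleus_sup:
  assumes A: "A \<subseteq> carrier Q"
  shows "j (\<Squnion>(j ` A)) = j (\<Squnion>A)"
proof (rule le_antisym)
  have jA: "j ` A \<subseteq> carrier Q"
    using A nucleus_closed by auto
  have "j x \<sqsubseteq> j (\<Squnion>A)" if "x \<in> A" for x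
    using A that by (intro nucleus_mono sup_upper) auto
  then have "\<Squnion>(j ` A) \<sqsubseteq> j (\<Squnion>A)"
    using A jA by (intro sup_least) (auto simp: nucleus_closed)
  then show "j (\<Squnion>(j ` A)) \<sqsubseteq> j (\<Squnion>A)"
    using A jA by (intro nucleus_least) auto
  have "x \<sqsubseteq> \<Squnion>(j ` A)" if "x \<in> A" for x
    using A jA that le_trans[OF nucleus_le[of x] sup_upper[OF jA]] by (auto simp: subset_iff nucleus_closed)
  then have "\<Squnion>A \<sqsubseteq> \<Squnion>(j ` A)"
    using A jA by (intro sup_least) auto
  then show "j (\<Squnion>A) \<sqsubseteq> j (\<Squnion>(j ` A))"
    using A jA by (intro nucleus_mono) auto
  show "j (\<Squnion>(j ` A)) \<in> carrier Q" "j (\<Squnion>A) \<in> carrier Q"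
    using A jA by (simp_all add: nucleus_closed)
qed

lemma nucleus_quotient_lattice:
  "complete_lattice (nucleus_quotient Q j)" "\<top>\<^bsub>nucleus_quotient Q j\<^esub> = \<top>"
proof -
  let ?F = "{x \<in> carrier Q. j x = x}"
  have F: "?F \<subseteq> carrier Q" by auto
  have inf: "\<Sqinter>A \<in> ?F" if A: "A \<subseteq> ?F" for A
  proof -
    have AQ: "A \<subseteq> carrier Q"
      using A by auto
    have "j (\<Sqinter>A) \<sqsubseteq> x" if x: "x \<in> A" for x
      using nucleus_mono[OF _ _ inf_lower[OF AQ x]] A AQ x by auto
    then have "j (\<Sqinter>A) \<sqsubseteq> \<Sqinter>A"
      using AQ by (intro inf_greatest) (auto simp: nucleus_closed)
    then have "j (\<Sqinter>A) = \<Sqinter>A"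
      using AQ nucleus_le[of "\<Sqinter>A"] by (intro le_antisym) (auto simp: nucleus_closed)
    then show ?thesis
      using AQ by simp
  qed
  show "complete_lattice (nucleus_quotient Q j)" "\<top>\<^bsub>nucleus_quotient Q j\<^esub> = \<top>"
    unfolding nucleus_quotient_def using inf_closed_subset(1,3)[OF F inf] by blast+
qed

lemma nucleus_quotient_sup:
  assumes A: "A \<subseteq> carrier (nucleus_quotient Q j)"
  shows "\<Squnion>\<^bsub>nucleus_quotient Q j\<^esub>A = j (\<Squnion>A)"
proof -
  interpret R: complete_lattice "nucleus_quotient Q j"
    by (rule nucleus_quotient_lattice)
  have AQ: "A \<subseteq> carrier Q"
    using A by (auto simp: nucleus_quotient_simps)
  have "x \<sqsubseteq> j (\<Squnion>A)" if "x \<in> A" for x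
    using le_trans[OF sup_upper[OF AQ that] nucleus_le[of "\<Squnion>A"]] AQ that
    by (auto simp: nucleus_closed)
  moreover have "j (\<Squnion>A) \<sqsubseteq> u" if "u \<in> carrier Q" "j u = u" "\<forall>x \<in> A. x \<sqsubseteq> u" for u
    using nucleus_least[of "\<Squnion>A" u] that AQ by (auto simp: sup_le_iff)
  ultimately have "j (\<Squnion>A) = \<Squnion>\<^bsub>nucleus_quotient Q j\<^esub>A"
    by (subst R.sup_char[OF A]) (use AQ in \<open>auto simp: nucleus_quotient_simps nucleus_closed nucleus_idem\<close>)
  then show ?thesis
    by simp
qed

lemma quantale_nucleus_quotient: "quantale (nucleus_quotient Q j)"
proof -
  interpret R: complete_lattice "nucleus_quotient Q j"
    by (rule nucleus_quotient_lattice)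
  show ?thesis
  proof unfold_locales
    fix a A assume a: "a \<in> carrier (nucleus_quotient Q j)" and A: "A \<subseteq> carrier (nucleus_quotient Q j)"
    have aQ: "a \<in> carrier Q" and AQ: "A \<subseteq> carrier Q"
      using a A by (auto simp: nucleus_quotient_simps)
    have img: "(\<lambda>x. a \<cdot> x) ` A \<subseteq> carrier Q" "(\<lambda>x. x \<cdot> a) ` A \<subseteq> carrier Q"
      using aQ AQ mult_closed by auto
    have img': "(\<lambda>x. j (a \<cdot> x)) ` A \<subseteq> carrier (nucleus_quotient Q j)"
      "(\<lambda>x. j (x \<cdot> a)) ` A \<subseteq> carrier (nucleus_quotient Q j)"
      using aQ AQ mult_closed by (auto simp: nucleus_quotient_simps nucleus_closed nucleus_idem subset_iff)
    have "j (a \<cdot> j (\<Squnion>A)) = j (\<Squnion>((\<lambda>x. j (a \<cdot> x)) ` A))"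
      using nucleus_sup[OF img(1)] aQ AQ by (simp add: image_image nucleus_mult mult_sup_right)
    moreover have "j (j (\<Squnion>A) \<cdot> a) = j (\<Squnion>((\<lambda>x. j (x \<cdot> a)) ` A))"
      using nucleus_sup[OF img(2)] aQ AQ by (simp add: image_image nucleus_mult mult_sup_left)
    ultimately show "a \<cdot>\<^bsub>nucleus_quotient Q j\<^esub> (\<Squnion>\<^bsub>nucleus_quotient Q j\<^esub>A) =
        \<Squnion>\<^bsub>nucleus_quotient Q j\<^esub>((\<lambda>x. a \<cdot>\<^bsub>nucleus_quotient Q j\<^esub> x) ` A)"
      "(\<Squnion>\<^bsub>nucleus_quotient Q j\<^esub>A) \<cdot>\<^bsub>nucleus_quotient Q j\<^esub> a =
        \<Squnion>\<^bsub>nucleus_quotient Q j\<^esub>((\<lambda>x. x \<cdot>\<^bsub>nucleus_quotient Q j\<^esub> a) ` A)"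
      using A img' by (simp_all add: nucleus_quotient_sup nucleus_quotient_simps(3))
  qed (simp_all add: nucleus_quotient_simps mult_closed nucleus_closed nucleus_idem nucleus_mult mult_assoc)
qed

lemma nucleus_epi: "j \<in> quantale_epi Q (nucleus_quotient Q j)"
proof -
  have "j \<in> quantale_hom Q (nucleus_quotient Q j)"
  proof (rule quantale_homI)
    fix A assume A: "A \<subseteq> carrier Q"
    then have "j ` A \<subseteq> carrier (nucleus_quotient Q j)"
      by (auto simp: nucleus_quotient_simps nucleus_closed nucleus_idem subset_iff)
    then show "j (\<Squnion>A) = \<Squnion>\<^bsub>nucleus_quotient Q j\<^esub>(j ` A)"
      using A by (simp add: nucleus_quotient_sup nucleus_sup)
  qed (simp_all add: nucleus_quotient_simps nucleus_closed nucleus_idem nucleus_mult)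
  moreover have "j ` carrier Q = carrier (nucleus_quotient Q j)"
  proof
    show "j ` carrier Q \<subseteq> carrier (nucleus_quotient Q j)"
      by (auto simp: nucleus_quotient_simps nucleus_closed nucleus_idem)
    show "carrier (nucleus_quotient Q j) \<subseteq> j ` carrier Q"
    proof
      fix x assume "x \<in> carrier (nucleus_quotient Q j)"
      then show "x \<in> j ` carrier Q"
        by (intro image_eqI[of x j x]) (auto simp: nucleus_quotient_simps)
    qed
  qed
  ultimately show ?thesis
    by (simp add: quantale_epi_def)
qed

lemma simple_nucleus:
  assumes "simple_quantale Q"
  shows "(\<forall>x \<in> carrier Q. j x = x) \<or> (\<forall>x \<in> carrier Q. j x = \<top>)"
proof -
  have "j \<in> quantale_iso Q (nucleus_quotient Q j) \<or>
      (\<exists>z. carrier (nucleus_quotient Q j) = {z} \<and> (\<forall>x \<in> carrier Q. j x = z))"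
    by (rule simple_quantaleD(3)[OF assms quantale_nucleus_quotient nucleus_epi])
  then show ?thesis
  proof
    assume "j \<in> quantale_iso Q (nucleus_quotient Q j)"
    then obtain g where g: "\<forall>x \<in> carrier Q. g (j x) = x"
      by (rule quantale_iso_sym)
    have "j x = x" if "x \<in> carrier Q" for x
      using g nucleus_idem that nucleus_closed by metis
    then show ?thesis
      by simp
  next
    assume "\<exists>z. carrier (nucleus_quotient Q j) = {z} \<and> (\<forall>x \<in> carrier Q. j x = z)"
    moreover have "j \<top> = \<top>"
      using nucleus_le[of \<top>] nucleus_closed[of \<top>] top_le_iff by simp
    ultimately show ?thesis
      using top_closed by metis
  qed
qed

end

section \<open>The simple quotient at a two-sided prime\<close>

text \<open>The meet of all residuals of \<open>t\<close> above \<open>x\<close>.\<close>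

definition saturation :: "'a \<Rightarrow> 'a \<Rightarrow> 'a" where
  "saturation t x =
     \<Squnion>{y \<in> carrier Q. \<forall>c \<in> carrier Q. \<forall>d \<in> carrier Q. d \<cdot> x \<cdot> c \<sqsubseteq> t \<longrightarrow> d \<cdot> y \<cdot> c \<sqsubseteq> t}"

lemma saturation_closed: "saturation t x \<in> carrier Q"
  unfolding saturation_def by (rule sup_closed) auto

lemma saturation_le:
  assumes "t \<in> carrier Q" "x \<in> carrier Q" "c \<in> carrier Q" "d \<in> carrier Q" "d \<cdot> x \<cdot> c \<sqsubseteq> t"
  shows "d \<cdot> saturation t x \<cdot> c \<sqsubseteq> t"
proof -
  have "saturation t x \<sqsubseteq> (c \<rightarrow>\<^bsub>Q\<^esub> t) \<leftarrow>\<^bsub>Q\<^esub> d"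
    unfolding saturation_def using assms
    by (intro sup_least) (auto simp: residual_closed le_residual)
  then show ?thesis
    using assms by (simp add: le_residual saturation_closed)
qed

lemma le_saturation_iff:
  assumes "t \<in> carrier Q" "x \<in> carrier Q" "y \<in> carrier Q"
  shows "y \<sqsubseteq> saturation t x \<longleftrightarrow>
    (\<forall>c \<in> carrier Q. \<forall>d \<in> carrier Q. d \<cdot> x \<cdot> c \<sqsubseteq> t \<longrightarrow> d \<cdot> y \<cdot> c \<sqsubseteq> t)"
proof
  assume y: "y \<sqsubseteq> saturation t x"
  show "\<forall>c \<in> carrier Q. \<forall>d \<in> carrier Q. d \<cdot> x \<cdot> c \<sqsubseteq> t \<longrightarrow> d \<cdot> y \<cdot> c \<sqsubseteq> t"
  proof (intro ballI impI)
    fix c d assume cd: "c \<in> carrier Q" "d \<in> carrier Q" "d \<cdot> x \<cdot> c \<sqsubseteq> t"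
    have "saturation t x \<sqsubseteq> (c \<rightarrow>\<^bsub>Q\<^esub> t) \<leftarrow>\<^bsub>Q\<^esub> d"
      using saturation_le[OF assms(1,2) cd] assms cd by (simp add: le_residual saturation_closed)
    then have "y \<sqsubseteq> (c \<rightarrow>\<^bsub>Q\<^esub> t) \<leftarrow>\<^bsub>Q\<^esub> d"
      using le_trans[OF y] assms by (simp add: residual_closed saturation_closed)
    then show "d \<cdot> y \<cdot> c \<sqsubseteq> t"
      using assms cd by (simp add: le_residual)
  qed
next
  assume "\<forall>c \<in> carrier Q. \<forall>d \<in> carrier Q. d \<cdot> x \<cdot> c \<sqsubseteq> t \<longrightarrow> d \<cdot> y \<cdot> c \<sqsubseteq> t"
  then show "y \<sqsubseteq> saturation t x"
    unfolding saturation_def using assms by (intro sup_upper) auto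
qed

lemma saturation_nucleus:
  assumes t: "t \<in> carrier Q"
  shows "nucleus Q (saturation t)"
  unfolding nucleus_def
proof (intro conjI ballI impI)
  fix x y assume xy: "x \<in> carrier Q" "y \<in> carrier Q"
  show "saturation t x \<sqsubseteq> saturation t y" if "x \<sqsubseteq> saturation t y"
    using that xy t saturation_le[OF t]
    by (simp add: le_saturation_iff[OF t _ xy(1)] le_saturation_iff[OF t _ saturation_closed])
  have "d \<cdot> (saturation t x \<cdot> saturation t y) \<cdot> c \<sqsubseteq> t"
    if cd: "c \<in> carrier Q" "d \<in> carrier Q" "d \<cdot> (x \<cdot> y) \<cdot> c \<sqsubseteq> t" for c d
  proof -
    have "d \<cdot> x \<cdot> (y \<cdot> c) \<sqsubseteq> t"
      using cd xy by (simp add: mult_closed mult_assoc)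
    then have "d \<cdot> saturation t x \<cdot> (y \<cdot> c) \<sqsubseteq> t"
      using saturation_le[OF t xy(1), of "y \<cdot> c" d] cd xy by (simp add: mult_closed)
    then have "(d \<cdot> saturation t x) \<cdot> y \<cdot> c \<sqsubseteq> t"
      using cd xy by (simp add: mult_closed mult_assoc saturation_closed)
    then have "(d \<cdot> saturation t x) \<cdot> saturation t y \<cdot> c \<sqsubseteq> t"
      using saturation_le[OF t xy(2), of c "d \<cdot> saturation t x"] cd
      by (simp add: mult_closed saturation_closed)
    then show ?thesis
      using cd by (simp add: mult_closed mult_assoc saturation_closed)
  qed
  then show "saturation t x \<cdot> saturation t y \<sqsubseteq> saturation t (x \<cdot> y)"
    using xy t by (simp add: le_saturation_iff mult_closed saturation_closed)
qed (auto simp: saturation_closed le_saturation_iff t)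

lemma saturation_bot:
  assumes t: "t \<in> two_sided_primes Q"
  shows "saturation t \<bottom> = t" "saturation t t = t"
proof -
  note tD = two_sided_primeD[OF t] and tM = two_sided_mult[OF two_sided_primeD(2)[OF t]]
  have "\<top> \<cdot> saturation t t \<cdot> \<top> \<sqsubseteq> t"
    using tM tD(1) by (intro saturation_le) (auto simp: mult_closed)
  then have le: "saturation t t \<sqsubseteq> t"
    using prime_sandwich[OF t saturation_closed] by simp
  have "t \<sqsubseteq> saturation t \<bottom>"
    using tM tD(1) by (simp add: le_saturation_iff mult_closed)
  moreover have "saturation t \<bottom> \<sqsubseteq> saturation t t"
    using nucleus_mono[OF saturation_nucleus[OF tD(1)]] tD(1) by simp
  ultimately show "saturation t \<bottom> = t" "saturation t t = t"
    using le le_trans tD(1) saturation_closed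
    by (metis le_antisym)+
qed

text \<open>
  By primeness, \<open>d (1 w 1) c \<le> t\<close> only if \<open>d\<close> or \<open>c\<close> is below \<open>t\<close>, and then \<open>d 1 c \<le> t\<close>.
\<close>

lemma saturation_sandwich:
  assumes t: "t \<in> two_sided_primes Q" and w: "w \<in> carrier Q" "\<not> w \<sqsubseteq> t"
  shows "saturation t (\<top> \<cdot> w \<cdot> \<top>) = \<top>"
proof -
  note tD = two_sided_primeD[OF t] and tM = two_sided_mult[OF two_sided_primeD(2)[OF t]]
  have "d \<cdot> \<top> \<cdot> c \<sqsubseteq> t" if cd: "c \<in> carrier Q" "d \<in> carrier Q" "d \<cdot> (\<top> \<cdot> w \<cdot> \<top>) \<cdot> c \<sqsubseteq> t" for c d
  proof -
    have "d \<sqsubseteq> t \<or> c \<sqsubseteq> t"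
      using prime_triple[OF t, of d w c] cd w by (simp add: mult_closed mult_assoc)
    then show ?thesis
      using tM cd by (auto simp: mult_closed)
  qed
  then have "\<top> \<sqsubseteq> saturation t (\<top> \<cdot> w \<cdot> \<top>)"
    using w tD(1) by (simp add: le_saturation_iff mult_closed)
  then show ?thesis
    by (simp add: top_le_iff saturation_closed)
qed

text \<open>
  Let a morphism \<open>f\<close> from the quotient identify \<open>x\<close> and \<open>y\<close>, where \<open>y \<le> x\<close> fails.  There are \<open>c, d\<close>
  with \<open>d x c \<le> t\<close> but not \<open>d y c \<le> t\<close>.  The products \<open>1 (d x c) 1\<close> and \<open>1 (d y c) 1\<close> represent
  bottom and top of the quotient, and \<open>f\<close> identifies them.
\<close>

lemma saturation_quotient_simple:
  assumes t: "t \<in> two_sided_primes Q"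
  shows "simple_quantale (nucleus_quotient Q (saturation t))" (is "simple_quantale ?R")
proof -
  note tD = two_sided_primeD[OF t] and tM = two_sided_mult[OF two_sided_primeD(2)[OF t]]
  note nuc = saturation_nucleus[OF tD(1)]
  interpret R: quantale ?R
    by (rule quantale_nucleus_quotient[OF nuc])
  have botR: "\<bottom>\<^bsub>?R\<^esub> = t" and topR: "\<top>\<^bsub>?R\<^esub> = \<top>"
    using epi_bounds[OF quantale_axioms R.quantale_axioms nucleus_epi[OF nuc]]
      saturation_bot[OF t] nucleus_quotient_lattice(2)[OF nuc] by simp_all
  have carR: "x \<in> carrier ?R \<longleftrightarrow> x \<in> carrier Q \<and> saturation t x = x" for x
    by (simp add: nucleus_quotient_simps)
  have "saturation t (\<top> \<cdot> \<top>) \<noteq> t"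
  proof
    assume "saturation t (\<top> \<cdot> \<top>) = t"
    then have "\<top> \<cdot> \<top> \<sqsubseteq> t"
      using nucleus_le[OF nuc, of "\<top> \<cdot> \<top>"] by (simp add: mult_closed)
    then have "\<top> \<cdot> \<top> \<cdot> \<top> \<sqsubseteq> t"
      using tM by (simp add: mult_closed)
    then show False
      using tD(3,4) by blast
  qed
  then have "\<top>\<^bsub>?R\<^esub> \<cdot>\<^bsub>?R\<^esub> \<top>\<^bsub>?R\<^esub> \<noteq> \<bottom>\<^bsub>?R\<^esub>"
    by (simp add: botR topR nucleus_quotient_simps(3))
  moreover have "f \<in> quantale_iso ?R X \<or> (\<exists>z. carrier X = {z} \<and> (\<forall>x \<in> carrier ?R. f x = z))"
    if X: "quantale X" and f: "f \<in> quantale_epi ?R X" for X :: "'a quantale_struct" and f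
  proof (cases "inj_on f (carrier ?R)")
    case True
    then show ?thesis
      using injective_epi_iso[OF R.quantale_axioms f] by simp
  next
    case False
    then obtain x y where xy: "x \<in> carrier ?R" "y \<in> carrier ?R" "f x = f y" "\<not> y \<sqsubseteq> x"
    proof -
      obtain v w where vw: "v \<in> carrier ?R" "w \<in> carrier ?R" "f v = f w" "v \<noteq> w"
        using False unfolding inj_on_def by blast
      then have "\<not> w \<sqsubseteq> v \<or> \<not> v \<sqsubseteq> w"
        using le_antisym[of v w] by (auto simp: carR)
      then show thesis
        using that[OF vw(1-3)] that[OF vw(2,1) vw(3)[symmetric]] by blast
    qed
    have hom: "f \<in> quantale_hom ?R X"
      using f by (simp add: quantale_epi_def)
    have xyQ: "x \<in> carrier Q" "y \<in> carrier Q" "saturation t x = x"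
      using xy by (simp_all add: carR)
    obtain c d where cd: "c \<in> carrier Q" "d \<in> carrier Q" "d \<cdot> x \<cdot> c \<sqsubseteq> t" "\<not> d \<cdot> y \<cdot> c \<sqsubseteq> t"
      using xy(4) le_saturation_iff[OF tD(1) xyQ(1,2)] xyQ(3) by auto
    let ?g = "f \<circ> saturation t"
    have g: "?g \<in> quantale_hom Q X"
      by (rule quantale_hom_comp[OF _ hom]) (use nucleus_epi[OF nuc] in \<open>simp add: quantale_epi_def\<close>)
    have gxy: "?g x = ?g y"
      using xy by (simp add: carR)
    have g_mult: "?g (\<top> \<cdot> (d \<cdot> z \<cdot> c) \<cdot> \<top>) =
        ?g \<top> \<cdot>\<^bsub>X\<^esub> (?g d \<cdot>\<^bsub>X\<^esub> ?g z \<cdot>\<^bsub>X\<^esub> ?g c) \<cdot>\<^bsub>X\<^esub> ?g \<top>" if "z \<in> carrier Q" for z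
      using that cd by (simp add: quantale_homD(3)[OF g] mult_closed del: comp_apply)
    have "saturation t (\<top> \<cdot> (d \<cdot> x \<cdot> c) \<cdot> \<top>) = t"
    proof (rule le_antisym)
      have "\<top> \<cdot> (d \<cdot> x \<cdot> c) \<cdot> \<top> \<sqsubseteq> t"
        using cd xyQ prime_sandwich[OF t] by (simp add: mult_closed)
      then show "saturation t (\<top> \<cdot> (d \<cdot> x \<cdot> c) \<cdot> \<top>) \<sqsubseteq> t"
        using nucleus_mono[OF nuc, of _ t] cd xyQ tD(1) saturation_bot(2)[OF t] mult_closed by simp
      show "t \<sqsubseteq> saturation t (\<top> \<cdot> (d \<cdot> x \<cdot> c) \<cdot> \<top>)"
        using nucleus_mono[OF nuc, of \<bottom>] cd xyQ tD(1) saturation_bot(1)[OF t]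
        by (simp add: mult_closed)
    qed (simp_all add: tD(1) saturation_closed)
    moreover have "saturation t (\<top> \<cdot> (d \<cdot> y \<cdot> c) \<cdot> \<top>) = \<top>"
      using saturation_sandwich[OF t] cd xyQ by (simp add: mult_closed)
    ultimately have "f t = f \<top>"
      using g_mult[OF xyQ(1)] g_mult[OF xyQ(2)] gxy by simp
    then show ?thesis
      using epi_constant[OF R.quantale_axioms X f] by (simp add: botR topR)
  qed
  ultimately show ?thesis
    unfolding simple_quantale_def using R.quantale_axioms by blast
qed

lemma prime_separation_semisimple:
  assumes "prime_residuals_separate Q"
  shows "semisimple_quantale Q"
proof -
  have sep: "\<exists>(R :: 'a quantale_struct) f. simple_quantale R \<and> f \<in> quantale_epi Q R \<and> f a \<noteq> f b"
    if ab: "a \<in> carrier Q" "b \<in> carrier Q" "\<not> b \<sqsubseteq> a" for a b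
  proof -
    obtain t c d where t: "t \<in> two_sided_primes Q" and cd: "c \<in> carrier Q" "d \<in> carrier Q"
      and dc: "d \<cdot> a \<cdot> c \<sqsubseteq> t" "\<not> d \<cdot> b \<cdot> c \<sqsubseteq> t"
      using prime_residuals_separateD[OF assms ab] by auto
    note tQ = two_sided_primeD(1)[OF t]
    have "\<not> b \<sqsubseteq> saturation t a"
      using le_saturation_iff[OF tQ ab(1,2)] cd dc by auto
    then have "saturation t a \<noteq> saturation t b"
      using nucleus_le[OF saturation_nucleus[OF tQ] ab(2)] by auto
    then show ?thesis
      using saturation_quotient_simple[OF t] nucleus_epi[OF saturation_nucleus[OF tQ]] by blast
  qed
  show ?thesis
    unfolding semisimple_quantale_def
  proof (intro ballI impI)
    fix a b assume ab: "a \<in> carrier Q" "b \<in> carrier Q" "a \<noteq> b"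
    then have "\<not> b \<sqsubseteq> a \<or> \<not> a \<sqsubseteq> b"
      using le_antisym by blast
    then show "\<exists>(R :: 'a quantale_struct) f. simple_quantale R \<and> f \<in> quantale_epi Q R \<and> f a \<noteq> f b"
      using sep[OF ab(1,2)] sep[OF ab(2,1)] by metis
  qed
qed


section \<open>Simple quantales\<close>

lemma two_sided_nucleus:
  assumes t: "t \<in> two_sided Q"
  shows "nucleus Q (\<lambda>x. \<Squnion>{x, t})"
  unfolding nucleus_def
proof (intro conjI ballI impI)
  have tQ: "t \<in> carrier Q"
    using t by (simp add: two_sided_iff)
  fix x y assume xy: "x \<in> carrier Q" "y \<in> carrier Q"
  show "\<Squnion>{x, t} \<sqsubseteq> \<Squnion>{y, t}" if "x \<sqsubseteq> \<Squnion>{y, t}"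
    using that xy tQ sup_upper[of "{y, t}" t] by (intro sup_least) auto
  have u: "x \<cdot> y \<sqsubseteq> \<Squnion>{x \<cdot> y, t}" "t \<sqsubseteq> \<Squnion>{x \<cdot> y, t}" "\<Squnion>{x \<cdot> y, t} \<in> carrier Q"
    using xy tQ by (auto intro!: sup_upper sup_closed simp: mult_closed)
  have t_mult: "z \<cdot> t \<sqsubseteq> \<Squnion>{x \<cdot> y, t}" "t \<cdot> z \<sqsubseteq> \<Squnion>{x \<cdot> y, t}" if z: "z \<in> carrier Q" for z
    using two_sided_mult[OF t tQ _ z] tQ z le_trans[OF _ u(2)] u(3) by (simp_all add: mult_closed)
  have "z \<cdot> \<Squnion>{y, t} \<sqsubseteq> \<Squnion>{x \<cdot> y, t}" if z: "z \<in> {x, t}" for z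
  proof -
    have zQ: "z \<in> carrier Q"
      using z xy tQ by auto
    have "z \<cdot> y \<sqsubseteq> \<Squnion>{x \<cdot> y, t}"
      using z u t_mult(2)[OF xy(2)] by auto
    then have "\<Squnion>((\<lambda>w. z \<cdot> w) ` {y, t}) \<sqsubseteq> \<Squnion>{x \<cdot> y, t}"
      using t_mult(1)[OF zQ] u(3) zQ xy tQ by (intro sup_least) (auto simp: mult_closed)
    then show ?thesis
      using mult_sup_right[OF zQ, of "{y, t}"] xy tQ by simp
  qed
  then have "\<Squnion>((\<lambda>z. z \<cdot> \<Squnion>{y, t}) ` {x, t}) \<sqsubseteq> \<Squnion>{x \<cdot> y, t}"
    using u(3) xy tQ by (intro sup_least) (auto simp: mult_closed)
  then show "\<Squnion>{x, t} \<cdot> \<Squnion>{y, t} \<sqsubseteq> \<Squnion>{x \<cdot> y, t}"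
    using mult_sup_left[of "\<Squnion>{y, t}" "{x, t}"] xy tQ by simp
qed (use t in \<open>auto simp: two_sided_iff intro: sup_upper\<close>)

text \<open>
  The nucleus joining with \<open>t\<close> has the value \<open>t\<close> at bottom, and it is the identity or constant.
\<close>

lemma simple_two_sided:
  assumes S: "simple_quantale Q" and t: "t \<in> two_sided Q"
  shows "t = \<bottom> \<or> t = \<top>"
proof -
  have tQ: "t \<in> carrier Q"
    using t by (simp add: two_sided_iff)
  have "\<Squnion>{\<bottom>, t} = t"
    using tQ by (intro sup_pair) auto
  then show ?thesis
    using simple_nucleus[OF two_sided_nucleus[OF t] S] by (metis bottom_closed)
qed

text \<open>
  Every two-sided element is bottom or top.  So \<open>1 1 = 1\<close>, because \<open>1 1\<close> is not bottom, and for
  the same reason the largest \<open>x\<close> with \<open>1 x 1 = 0\<close> is bottom.  Hence \<open>1 x 1 = 1\<close> for all \<open>x \<noteq> 0\<close>,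
  and \<open>a 1 b = 0\<close> for nonzero \<open>a, b\<close> would give \<open>1 = (1 a 1) (1 b 1) = 0\<close>.
\<close>

lemma simple_bot_prime:
  assumes S: "simple_quantale Q"
  shows "\<bottom> \<in> two_sided_primes Q"
proof -
  have "\<top> \<cdot> \<top> \<in> two_sided Q"
    by (auto simp: two_sided_iff mult_closed intro!: mult_mono)
  then have tt: "\<top> \<cdot> \<top> = \<top>"
    using simple_two_sided[OF S] simple_quantaleD(2)[OF S] by auto
  have bt: "\<bottom> \<noteq> \<top>"
    using simple_quantaleD(2)[OF S] mult_bot(1)[OF bottom_closed] by auto
  have "(\<top> \<rightarrow>\<^bsub>Q\<^esub> \<bottom>) \<leftarrow>\<^bsub>Q\<^esub> \<top> \<noteq> \<top>"
    using le_residual[of \<top> \<top> \<top> \<bottom>] tt bt by (auto simp: le_bot_iff)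
  then have "(\<top> \<rightarrow>\<^bsub>Q\<^esub> \<bottom>) \<leftarrow>\<^bsub>Q\<^esub> \<top> = \<bottom>"
    using simple_two_sided[OF S residual_top_two_sided[OF bottom_closed]] by auto
  then have zero: "x = \<bottom>" if "x \<in> carrier Q" "\<top> \<cdot> x \<cdot> \<top> = \<bottom>" for x
    using le_residual[of x \<top> \<top> \<bottom>] that by (simp add: le_bot_iff)
  have full: "\<top> \<cdot> x \<cdot> \<top> = \<top>" if "x \<in> carrier Q" "x \<noteq> \<bottom>" for x
    using simple_two_sided[OF S sandwich_two_sided[OF that(1)]] zero that by auto
  have "a = \<bottom> \<or> b = \<bottom>" if ab: "a \<in> carrier Q" "b \<in> carrier Q" "a \<cdot> \<top> \<cdot> b = \<bottom>" for a b
  proof (rule ccontr)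
    assume "\<not> (a = \<bottom> \<or> b = \<bottom>)"
    then have "(\<top> \<cdot> a \<cdot> \<top>) \<cdot> (\<top> \<cdot> b \<cdot> \<top>) = \<top>"
      using full ab tt by simp
    moreover have "(\<top> \<cdot> a \<cdot> \<top>) \<cdot> (\<top> \<cdot> b \<cdot> \<top>) = \<top> \<cdot> (a \<cdot> (\<top> \<cdot> \<top>) \<cdot> b) \<cdot> \<top>"
      using ab by (simp add: mult_closed mult_assoc)
    ultimately show False
      using tt ab(3) bt by (simp add: mult_bot)
  qed
  then show ?thesis
    using bt
    by (auto simp: two_sided_primes_def quantale_primes_def two_sided_iff mult_bot mult_closed le_bot_iff)
qed

text \<open>
  The nucleus of the prime bottom is not constant, as it fixes bottom; so it is the identity.
\<close>

lemma simple_bot_separates: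
  assumes S: "simple_quantale Q" and ab: "a \<in> carrier Q" "b \<in> carrier Q" "\<not> b \<sqsubseteq> a"
  obtains c d where "c \<in> carrier Q" "d \<in> carrier Q" "d \<cdot> a \<cdot> c \<sqsubseteq> \<bottom>" "\<not> d \<cdot> b \<cdot> c \<sqsubseteq> \<bottom>"
proof -
  note bot = simple_bot_prime[OF S]
  have "saturation \<bottom> \<bottom> \<noteq> \<top>"
    using saturation_bot(1)[OF bot] two_sided_primeD(3)[OF bot] by auto
  then have "saturation \<bottom> a = a"
    using simple_nucleus[OF saturation_nucleus[OF bottom_closed] S] ab(1) bottom_closed by blast
  then have "\<not> b \<sqsubseteq> saturation \<bottom> a"
    using ab(3) by simp
  then show thesis
    using that le_saturation_iff[OF bottom_closed ab(1,2)] by auto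
qed

text \<open>
  The element \<open>t\<close> is the value at \<open>u\<close> of the right adjoint of \<open>f\<close>; the properties of \<open>u\<close> carry over
  because \<open>f\<close> preserves products and, being surjective, top.
\<close>

lemma two_sided_prime_vimage:
  assumes R: "quantale R" and f: "f \<in> quantale_epi Q R" and u: "u \<in> two_sided_primes R"
  shows "\<exists>t \<in> two_sided_primes Q. \<forall>x \<in> carrier Q. x \<sqsubseteq> t \<longleftrightarrow> f x \<sqsubseteq>\<^bsub>R\<^esub> u"
proof -
  interpret R: quantale R by (rule R)
  note uD = R.two_sided_primeD[OF u] and uM = R.two_sided_mult[OF R.two_sided_primeD(2)[OF u]]
  have h: "f \<in> quantale_hom Q R"
    using f by (simp add: quantale_epi_def)
  note fD = quantale_homD[OF h]
  have ftop: "f \<top> = \<top>\<^bsub>R\<^esub>"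
    by (rule epi_bounds(2)[OF quantale_axioms R f])
  let ?A = "{x \<in> carrier Q. f x \<sqsubseteq>\<^bsub>R\<^esub> u}"
  let ?t = "\<Squnion>?A"
  have A: "?A \<subseteq> carrier Q" by auto
  have tQ: "?t \<in> carrier Q"
    by (rule sup_closed[OF A])
  have ft: "f ?t \<sqsubseteq>\<^bsub>R\<^esub> u"
    unfolding fD(2)[OF A] using fD(1) uD(1) by (intro R.sup_least) auto
  have le_t: "x \<sqsubseteq> ?t \<longleftrightarrow> f x \<sqsubseteq>\<^bsub>R\<^esub> u" if x: "x \<in> carrier Q" for x
  proof
    assume "x \<sqsubseteq> ?t"
    then have "f x \<sqsubseteq>\<^bsub>R\<^esub> f ?t"
      using hom_mono[OF quantale_axioms R h x tQ] by simp
    then show "f x \<sqsubseteq>\<^bsub>R\<^esub> u"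
      by (rule R.le_trans[OF _ ft fD(1)[OF x] fD(1)[OF tQ] uD(1)])
  qed (use x in \<open>auto intro!: sup_upper\<close>)
  have "?t \<in> two_sided Q"
    using tQ ft uM[OF fD(1)[OF tQ]] by (simp add: two_sided_iff le_t mult_closed fD(3) ftop)
  moreover have "?t \<noteq> \<top>"
    using ft uD(3) ftop by auto
  moreover have "a \<sqsubseteq> ?t \<or> b \<sqsubseteq> ?t" if ab: "a \<in> carrier Q" "b \<in> carrier Q" "a \<cdot> \<top> \<cdot> b \<sqsubseteq> ?t" for a b
    using ab uD(4)[of "f a" "f b"] by (simp add: le_t mult_closed fD(1,3) ftop)
  ultimately have "?t \<in> two_sided_primes Q"
    using tQ by (auto simp: two_sided_primes_def quantale_primes_def)
  then show ?thesis
    using le_t by blast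
qed

text \<open>
  A quotient that distinguishes \<open>a\<close> from \<open>a \<squnion> b\<close> maps \<open>b\<close> to an element not below the image of
  \<open>a\<close>; the multipliers found there lift along the surjection.
\<close>

lemma semisimple_prime_separation:
  assumes ss: "semisimple_quantale Q"
  shows "prime_residuals_separate Q"
  unfolding prime_residuals_separate_def
proof (intro ballI impI)
  fix a b assume ab: "a \<in> carrier Q" "b \<in> carrier Q" "\<not> b \<sqsubseteq> a"
  have "a \<noteq> \<Squnion>{a, b}"
    using ab sup_upper[of "{a, b}" b] by auto
  then obtain R :: "'a quantale_struct" and f where S: "simple_quantale R"
    and f: "f \<in> quantale_epi Q R" and neq: "f a \<noteq> f (\<Squnion>{a, b})"
    using ss[unfolded semisimple_quantale_def, rule_format, of a "\<Squnion>{a, b}"] ab by auto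
  interpret R: quantale R
    by (rule simple_quantaleD(1)[OF S])
  have h: "f \<in> quantale_hom Q R" and img: "f ` carrier Q = carrier R"
    using f by (auto simp: quantale_epi_def)
  note fD = quantale_homD[OF h]
  have fab: "f a \<in> carrier R" "f b \<in> carrier R"
    using fD(1) ab by auto
  have "\<not> f b \<sqsubseteq>\<^bsub>R\<^esub> f a"
    using neq fD(2)[of "{a, b}"] R.sup_pair[of "f b" "f a"] fab ab by (auto simp: insert_commute)
  then obtain c' d' where cd': "c' \<in> carrier R" "d' \<in> carrier R"
    and sep: "d' \<cdot>\<^bsub>R\<^esub> f a \<cdot>\<^bsub>R\<^esub> c' \<sqsubseteq>\<^bsub>R\<^esub> \<bottom>\<^bsub>R\<^esub>" "\<not> d' \<cdot>\<^bsub>R\<^esub> f b \<cdot>\<^bsub>R\<^esub> c' \<sqsubseteq>\<^bsub>R\<^esub> \<bottom>\<^bsub>R\<^esub>"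
    using R.simple_bot_separates[OF S fab] by blast
  obtain c d where cd: "c \<in> carrier Q" "d \<in> carrier Q" "f c = c'" "f d = d'"
    using cd' unfolding img[symmetric] by blast
  obtain t where t: "t \<in> two_sided_primes Q"
    and le_t: "\<And>x. x \<in> carrier Q \<Longrightarrow> x \<sqsubseteq> t \<longleftrightarrow> f x \<sqsubseteq>\<^bsub>R\<^esub> \<bottom>\<^bsub>R\<^esub>"
    using two_sided_prime_vimage[OF R.quantale_axioms f R.simple_bot_prime[OF S]] by auto
  have "d \<cdot> a \<cdot> c \<sqsubseteq> t" "\<not> d \<cdot> b \<cdot> c \<sqsubseteq> t"
    using sep cd ab by (simp_all add: le_t mult_closed fD(3))
  then show "\<exists>t \<in> two_sided_primes Q. \<exists>c \<in> carrier Q. \<exists>d \<in> carrier Q.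
      d \<cdot> a \<cdot> c \<sqsubseteq> t \<and> \<not> d \<cdot> b \<cdot> c \<sqsubseteq> t"
    using t cd by (intro bexI conjI)
qed

end

theorem theorem2p13:
  fixes Q :: "'a quantale_struct"
  assumes "quantale Q"
  shows "(semisimple_quantale Q \<longleftrightarrow> strictly_faithful Q \<and> spatial_quantale Q) \<and>
    (strictly_faithful Q \<and> spatial_quantale Q \<longleftrightarrow>
       strictly_faithful Q \<and> spatial_locale (two_sided_quantale Q)) \<and>
    (strictly_faithful Q \<and> spatial_locale (two_sided_quantale Q) \<longleftrightarrow>
       separating Q (\<Union>{P. cyclic_set Q P}))"
proof -
  interpret quantale Q by (rule assms)
  have "semisimple_quantale Q \<longleftrightarrow> prime_residuals_separate Q"
    using prime_separation_semisimple semisimple_prime_separation by blast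
  moreover have "strictly_faithful Q \<and> spatial_quantale Q \<longleftrightarrow> prime_residuals_separate Q"
    using prime_separation_strictly_faithful prime_separation_spatial
      spatial_two_sided_locale spatial_locale_prime_separation by blast
  moreover have "strictly_faithful Q \<and> spatial_locale (two_sided_quantale Q) \<longleftrightarrow>
      prime_residuals_separate Q"
    using prime_separation_strictly_faithful prime_separation_spatial
      spatial_two_sided_locale spatial_locale_prime_separation by blast
  ultimately show ?thesis
    using separating_cyclic_iff by simp
qed

end
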